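(* Let $(X,d)$ be a finite metric space, and consider the associated $W^*$-quantum metric space with $\mathcal{M}=\ell^\infty(X)$, $\mathcal{H}=\ell^2(X)$ and $\mathcal{V}_t=\{A\in B(\ell^2(X)) \mid \langle Ae_y,e_x\rangle=0 \text{ if } d(x,y)>t\}$ for $t\ge 0$, where $\{e_x\}_{x\in X}$ is the standard orthonormal basis. Then the quantum isometry group of the metric space $(X,d)$ is the same as the quantum isometry group of the corresponding $W^*$-quantum metric space, that is, $G^{\mathcal{V}}\cong G^+(X,d)$ as compact quantum groups.
   Context: A compact quantum group $G$ is a unital $C^*$-algebra $C(G)$ with a coassociative unital $*$-homomorphism $\Delta:C(G)\to C(G)\otimes C(G)$ satisfying the usual cancellation (density) property. Banica's quantum isometry group $G^+(X,d)$ of a finite metric space with $|X|=n$: $C(G^+(X,d))=C(S_n^+)/\langle UD=DU\rangle$, where $C(S_n^+)$ is the universal unital $C^*$-algebra generated by the entries of an $n\times n$ magic unitary $U=[u_{xy}]_{x,y\in X}$ (that is, $u_{xy}=u_{xy}^*=u_{xy}^2$ and every row and every column sums to $1$), and $D=[d(x,y)]_{x,y\in X}$ is the distance matrix; $\Delta(u_{xy})=\sum_z u_{xz}\otimes u_{zy}$. A $W^*$-quantum metric on a von Neumann algebra $\mathcal{M}\subseteq B(\mathcal{H})$ is a family $\mathcal{V}=\{\mathcal{V}_t\}_{t\ge0}$ of weak*-closed operator systems in $B(\mathcal{H})$ with $\mathcal{V}_s\mathcal{V}_t\subseteq\mathcal{V}_{s+t}$, $\mathcal{V}_t=\bigcap_{s>t}\mathcal{V}_s$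 and $\mathcal{V}_0=\mathcal{M}'$; the family in the claim is one. Quantum isometry group $G^{\mathcal V}$ of a finite dimensional $W^*$-quantum metric space: let $\mathcal{M}$ be finite dimensional with its canonical trace $\psi$ fixed (for $\mathcal M=\ell^\infty(X)$, the uniform trace), $\mathcal{H}=L^2(\mathcal{M})$ identified with $\mathcal{M}$ as a vector space, and $\{e_j\}$ an orthonormal basis of it. $C(G^{\mathcal V})$ is the universal unital $C^*$-algebra generated by the entries of a unitary $U=[u_{ij}]\in B(\mathcal{H})\otimes C(G^{\mathcal V})$ such that the map $\delta:\mathcal{M}\to\mathcal{M}\otimes C(G^{\mathcal V})$, $e_j\mapsto\sum_k e_k\otimes u_{kj}$, is a $\psi$-preserving unital $*$-homomorphism and $U(T\otimes1)U^*\in\mathcal{V}_t\otimes C(G^{\mathcal V})$ for all $T\in\mathcal{V}_t$ and all $t\ge0$. The comultiplication is $\Delta(u_{ij})=\sum_k u_{ik}\otimes u_{kj}$. For $\mathcal M=\ell^\infty(X)$ one takes the basis elements $e_x$ to be (scalar multiples of) the indicator functions of points, which identifies $L^2(\mathcal{M})$ with $\ell^2(X)$. *)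

theory Defs
  imports "HOL-Algebra.Module" "HOL-Analysis.Analysis" "HOL-Library.Poly_Mapping"
begin

section \<open>*-algebras, C*-seminorms and completions\<close>

text \<open>
  Complex unital *-algebras are records on top of the ring and module records of HOL-Algebra, so
  that they can be built from other data (generators and relations, tensor products).
\<close>

record 'a star_algebra = "(complex, 'a) module" +
  star :: "'a \<Rightarrow> 'a"

record 'a cstar_algebra = "'a star_algebra" +
  nrm :: "'a \<Rightarrow> real"

definition unital_star_hom ::
    "('a, 'm) star_algebra_scheme \<Rightarrow> ('b, 'n) star_algebra_scheme \<Rightarrow> ('a \<Rightarrow> 'b) \<Rightarrow> bool" where
  "unital_star_hom A B \<phi> \<longleftrightarrow>
     \<phi> \<in> ring_hom A B \<and>
     (\<forall>c. \<forall>a\<in>carrier A. \<phi> (c \<odot>\<^bsub>A\<^esub> a) = c \<odot>\<^bsub>B\<^esub> \<phi> a) \<and>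
     (\<forall>a\<in>carrier A. \<phi> (star A a) = star B (\<phi> a))"

definition cstar_seminorm :: "('a, 'm) star_algebra_scheme \<Rightarrow> ('a \<Rightarrow> real) \<Rightarrow> bool" where
  "cstar_seminorm P p \<longleftrightarrow>
     (\<forall>a\<in>carrier P. 0 \<le> p a) \<and>
     (\<forall>a\<in>carrier P. \<forall>b\<in>carrier P. p (a \<oplus>\<^bsub>P\<^esub> b) \<le> p a + p b) \<and>
     (\<forall>c. \<forall>a\<in>carrier P. p (c \<odot>\<^bsub>P\<^esub> a) = cmod c * p a) \<and>
     (\<forall>a\<in>carrier P. \<forall>b\<in>carrier P. p (a \<otimes>\<^bsub>P\<^esub> b) \<le> p a * p b) \<and>
     (\<forall>a\<in>carrier P. p (star P a \<otimes>\<^bsub>P\<^esub> a) = (p a)\<^sup>2)"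

text \<open>
  The Hausdorff completion of a *-algebra with respect to a C*-seminorm: Cauchy sequences modulo
  null sequences. It is a unital C*-algebra. (The zero algebra is allowed.)
\<close>

definition cauchy_seqs :: "('a, 'm) star_algebra_scheme \<Rightarrow> ('a \<Rightarrow> real) \<Rightarrow> (nat \<Rightarrow> 'a) set" where
  "cauchy_seqs P p =
     {s. range s \<subseteq> carrier P \<and> (\<forall>\<epsilon>>0. \<exists>N. \<forall>m\<ge>N. \<forall>n\<ge>N. p (s m \<ominus>\<^bsub>P\<^esub> s n) < \<epsilon>)}"

definition cauchy_class ::
    "('a, 'm) star_algebra_scheme \<Rightarrow> ('a \<Rightarrow> real) \<Rightarrow> (nat \<Rightarrow> 'a) \<Rightarrow> (nat \<Rightarrow> 'a) set" where
  "cauchy_class P p s = {t \<in> cauchy_seqs P p. (\<lambda>n. p (s n \<ominus>\<^bsub>P\<^esub> t n)) \<longlonglongrightarrow> 0}"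

definition completion ::
    "('a, 'm) star_algebra_scheme \<Rightarrow> ('a \<Rightarrow> real) \<Rightarrow> (nat \<Rightarrow> 'a) set cstar_algebra" where
  "completion P p =
     \<lparr>carrier = cauchy_class P p ` cauchy_seqs P p,
      monoid.mult = (\<lambda>S T. \<Union>s\<in>S. \<Union>t\<in>T. cauchy_class P p (\<lambda>n. s n \<otimes>\<^bsub>P\<^esub> t n)),
      one = cauchy_class P p (\<lambda>_. \<one>\<^bsub>P\<^esub>),
      zero = cauchy_class P p (\<lambda>_. \<zero>\<^bsub>P\<^esub>),
      add = (\<lambda>S T. \<Union>s\<in>S. \<Union>t\<in>T. cauchy_class P p (\<lambda>n. s n \<oplus>\<^bsub>P\<^esub> t n)),
      module.smult = (\<lambda>c S. \<Union>s\<in>S. cauchy_class P p (\<lambda>n. c \<odot>\<^bsub>P\<^esub> s n)),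
      star = (\<lambda>S. \<Union>s\<in>S. cauchy_class P p (\<lambda>n. star P (s n))),
      nrm = (\<lambda>S. lim (\<lambda>n. p ((SOME s. s \<in> S) n)))\<rparr>"

definition completion_emb ::
    "('a, 'm) star_algebra_scheme \<Rightarrow> ('a \<Rightarrow> real) \<Rightarrow> 'a \<Rightarrow> (nat \<Rightarrow> 'a) set" where
  "completion_emb P p a = cauchy_class P p (\<lambda>_. a)"


section \<open>Universal unital C*-algebras\<close>

text \<open>
  The free unital *-algebra on \<open>'g\<close> is the monoid algebra of words over the letters \<open>(g, False)\<close>,
  standing for \<open>g\<close>, and \<open>(g, True)\<close>, standing for \<open>g\<^sup>*\<close>. The additive monoid structure on words
  is the one that the multiplication of \<open>poly_mapping\<close> refers to.
\<close>

datatype 'g star_word = Word "('g \<times> bool) list"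

instantiation star_word :: (type) monoid_add
begin

definition zero_star_word :: "'g star_word" where
  "zero_star_word = Word []"

fun plus_star_word :: "'g star_word \<Rightarrow> 'g star_word \<Rightarrow> 'g star_word" where
  "plus_star_word (Word v) (Word w) = Word (v @ w)"

instance
proof
  fix a b c :: "'g star_word"
  show "a + b + c = a + (b + c)" by (cases a; cases b; cases c) simp
  show "0 + a = a" by (cases a) (simp add: zero_star_word_def)
  show "a + 0 = a" by (cases a) (simp add: zero_star_word_def)
qed

end

fun word_star :: "'g star_word \<Rightarrow> 'g star_word" where
  "word_star (Word w) = Word (rev (map (apsnd Not) w))"

type_synonym 'g star_poly = "'g star_word \<Rightarrow>\<^sub>0 complex"

definition free_star_algebra :: "'g star_poly star_algebra" where
  "free_star_algebra =
     \<lparr>carrier = UNIV, monoid.mult = (*), one = 1, zero = 0, add = (+),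
      module.smult = (\<lambda>c a. Poly_Mapping.single 0 c * a),
      star = (\<lambda>a. \<Sum>w\<in>Poly_Mapping.keys a.
                Poly_Mapping.single (word_star w) (cnj (Poly_Mapping.lookup a w)))\<rparr>"

definition generator :: "'g \<Rightarrow> 'g star_poly" where
  "generator g = Poly_Mapping.single (Word [(g, False)]) 1"

text \<open>
  The universal unital C*-algebra generated by the entries of a matrix \<open>u\<close> indexed by \<open>'i\<close>
  subject to a condition \<open>R A u\<close> on a C*-algebra \<open>A\<close> and a matrix \<open>u\<close> over \<open>A\<close>. A C*-algebra
  generated by such a matrix is the completion of the free *-algebra on the matrix entries for a
  C*-seminorm, and the universal one belongs to the largest of these C*-seminorms.
\<close>

type_synonym 'i univ_elem = "(nat \<Rightarrow> ('i \<times> 'i) star_poly) set"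

type_synonym 'i matrix_relations =
  "'i univ_elem cstar_algebra \<Rightarrow> ('i \<Rightarrow> 'i \<Rightarrow> 'i univ_elem) \<Rightarrow> bool"

definition generator_matrix :: "(('i \<times> 'i) star_poly \<Rightarrow> real) \<Rightarrow> 'i \<Rightarrow> 'i \<Rightarrow> 'i univ_elem" where
  "generator_matrix p = (\<lambda>i j. completion_emb free_star_algebra p (generator (i, j)))"

definition admissible_seminorm ::
    "'i matrix_relations \<Rightarrow> (('i \<times> 'i) star_poly \<Rightarrow> real) \<Rightarrow> bool" where
  "admissible_seminorm R p \<longleftrightarrow>
     cstar_seminorm free_star_algebra p \<and>
     R (completion free_star_algebra p) (generator_matrix p)"

definition universal_seminorm :: "'i matrix_relations \<Rightarrow> ('i \<times> 'i) star_poly \<Rightarrow> real" where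
  "universal_seminorm R a = Sup {p a | p. admissible_seminorm R p}"

definition universal_cstar_algebra :: "'i matrix_relations \<Rightarrow> 'i univ_elem cstar_algebra" where
  "universal_cstar_algebra R = completion free_star_algebra (universal_seminorm R)"

definition universal_matrix :: "'i matrix_relations \<Rightarrow> 'i \<Rightarrow> 'i \<Rightarrow> 'i univ_elem" where
  "universal_matrix R = generator_matrix (universal_seminorm R)"


section \<open>Spatial tensor product\<close>

text \<open>
  Formal linear combinations of pairs \<open>(a, b)\<close>, multiplied componentwise. The bilinearity relations
  need not be imposed, since the difference of the two sides of each has spatial seminorm zero.
\<close>

definition formal_tensor ::
    "('a, 'm) star_algebra_scheme \<Rightarrow> ('b, 'n) star_algebra_scheme \<Rightarrow>
     ('a \<times> 'b \<Rightarrow>\<^sub>0 complex) star_algebra" where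
  "formal_tensor A B =
     \<lparr>carrier = {x. Poly_Mapping.keys x \<subseteq> carrier A \<times> carrier B},
      monoid.mult = (\<lambda>x y. \<Sum>(a, b)\<in>Poly_Mapping.keys x. \<Sum>(a', b')\<in>Poly_Mapping.keys y.
                Poly_Mapping.single (a \<otimes>\<^bsub>A\<^esub> a', b \<otimes>\<^bsub>B\<^esub> b')
                  (Poly_Mapping.lookup x (a, b) * Poly_Mapping.lookup y (a', b'))),
      one = Poly_Mapping.single (\<one>\<^bsub>A\<^esub>, \<one>\<^bsub>B\<^esub>) 1,
      zero = 0,
      add = (+),
      module.smult = (\<lambda>c. Poly_Mapping.map ((*) c)),
      star = (\<lambda>x. \<Sum>(a, b)\<in>Poly_Mapping.keys x.
                Poly_Mapping.single (star A a, star B b) (cnj (Poly_Mapping.lookup x (a, b))))\<rparr>"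

definition positive_functional :: "('a, 'm) star_algebra_scheme \<Rightarrow> ('a \<Rightarrow> complex) \<Rightarrow> bool" where
  "positive_functional A f \<longleftrightarrow>
     (\<forall>a\<in>carrier A. \<forall>b\<in>carrier A. f (a \<oplus>\<^bsub>A\<^esub> b) = f a + f b) \<and>
     (\<forall>c. \<forall>a\<in>carrier A. f (c \<odot>\<^bsub>A\<^esub> a) = c * f a) \<and>
     (\<forall>a\<in>carrier A. f (star A a \<otimes>\<^bsub>A\<^esub> a) \<in> \<real> \<and> 0 \<le> Re (f (star A a \<otimes>\<^bsub>A\<^esub> a)))"

definition product_functional ::
    "('a \<Rightarrow> complex) \<Rightarrow> ('b \<Rightarrow> complex) \<Rightarrow> ('a \<times> 'b \<Rightarrow>\<^sub>0 complex) \<Rightarrow> complex" where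
  "product_functional f g x =
     (\<Sum>(a, b)\<in>Poly_Mapping.keys x. Poly_Mapping.lookup x (a, b) * f a * g b)"

text \<open>
  The norm of \<open>x\<close> in the direct sum of the representations \<open>\<pi>\<^sub>f \<otimes> \<pi>\<^sub>g\<close>, where \<open>\<pi>\<^sub>f\<close>, \<open>\<pi>\<^sub>g\<close> are the GNS
  representations of positive functionals of \<open>A\<close> and \<open>B\<close>, that is, the spatial (minimal) norm
  computed with the universal representations of \<open>A\<close> and \<open>B\<close>. The vectors
  \<open>(\<pi>\<^sub>f \<otimes> \<pi>\<^sub>g)(y) (\<xi>\<^sub>f \<otimes> \<xi>\<^sub>g)\<close> are dense, and the functional \<open>f \<otimes> g\<close> yields their norms.
\<close>

definition spatial_seminorm ::
    "('a, 'm) star_algebra_scheme \<Rightarrow> ('b, 'n) star_algebra_scheme \<Rightarrow>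
     ('a \<times> 'b \<Rightarrow>\<^sub>0 complex) \<Rightarrow> real" where
  "spatial_seminorm A B x =
     (let P = formal_tensor A B;
          sqnorm = (\<lambda>f g y. Re (product_functional f g (star P y \<otimes>\<^bsub>P\<^esub> y)))
      in sqrt (Sup {sqnorm f g (x \<otimes>\<^bsub>P\<^esub> y) | f g y.
           positive_functional A f \<and> positive_functional B g \<and>
           y \<in> carrier P \<and> sqnorm f g y \<le> 1}))"

type_synonym ('a, 'b) tensor_elem = "(nat \<Rightarrow> ('a \<times> 'b \<Rightarrow>\<^sub>0 complex)) set"

definition tensor ::
    "('a, 'm) star_algebra_scheme \<Rightarrow> ('b, 'n) star_algebra_scheme \<Rightarrow>
     ('a, 'b) tensor_elem cstar_algebra" where
  "tensor A B = completion (formal_tensor A B) (spatial_seminorm A B)"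

definition pure_tensor ::
    "('a, 'm) star_algebra_scheme \<Rightarrow> ('b, 'n) star_algebra_scheme \<Rightarrow> 'a \<Rightarrow> 'b \<Rightarrow>
     ('a, 'b) tensor_elem" where
  "pure_tensor A B a b =
     completion_emb (formal_tensor A B) (spatial_seminorm A B) (Poly_Mapping.single (a, b) 1)"


section \<open>Compact quantum groups\<close>

record 'a cqg =
  alg :: "'a cstar_algebra"
  comult :: "'a \<Rightarrow> ('a, 'a) tensor_elem"

text \<open>
  The quantum group given by a C*-algebra \<open>A\<close> generated by the entries of \<open>u\<close>, with the
  comultiplication determined by \<open>\<Delta>(u\<^sub>i\<^sub>j) = \<Sum>\<^sub>k u\<^sub>i\<^sub>k \<otimes> u\<^sub>k\<^sub>j\<close>. Extensionality only makes \<open>\<Delta>\<close> unique as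
  a function on the type \<open>'a\<close>.
\<close>

definition matrix_quantum_group ::
    "'a cstar_algebra \<Rightarrow> ('i::finite \<Rightarrow> 'i \<Rightarrow> 'a) \<Rightarrow> 'a cqg" where
  "matrix_quantum_group A u =
     \<lparr>alg = A,
      comult = (THE \<Delta>. \<Delta> \<in> extensional (carrier A) \<and>
        unital_star_hom A (tensor A A) \<Delta> \<and>
        (\<forall>i j. \<Delta> (u i j) = finsum (tensor A A) (\<lambda>k. pure_tensor A A (u i k) (u k j)) UNIV))\<rparr>"

text \<open>
  In the following definition \<open>\<Phi>\<close> is \<open>\<phi> \<otimes> \<phi>\<close>.
\<close>

definition cqg_isomorphic :: "'a cqg \<Rightarrow> 'b cqg \<Rightarrow> bool" where
  "cqg_isomorphic G H \<longleftrightarrow>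
     (\<exists>\<phi> \<Phi>.
        unital_star_hom (alg G) (alg H) \<phi> \<and>
        bij_betw \<phi> (carrier (alg G)) (carrier (alg H)) \<and>
        (\<forall>a\<in>carrier (alg G). nrm (alg H) (\<phi> a) = nrm (alg G) a) \<and>
        unital_star_hom (tensor (alg G) (alg G)) (tensor (alg H) (alg H)) \<Phi> \<and>
        (\<forall>a\<in>carrier (alg G). \<forall>b\<in>carrier (alg G).
           \<Phi> (pure_tensor (alg G) (alg G) a b) = pure_tensor (alg H) (alg H) (\<phi> a) (\<phi> b)) \<and>
        (\<forall>a\<in>carrier (alg G). \<Phi> (comult G a) = comult H (\<phi> a)))"


section \<open>Banica's quantum isometry group of a finite metric space\<close>

definition magic_unitary ::
    "('a, 'm) star_algebra_scheme \<Rightarrow> ('x::finite \<Rightarrow> 'x \<Rightarrow> 'a) \<Rightarrow> bool" where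
  "magic_unitary A u \<longleftrightarrow>
     (\<forall>x y. u x y \<in> carrier A \<and> star A (u x y) = u x y \<and> u x y \<otimes>\<^bsub>A\<^esub> u x y = u x y) \<and>
     (\<forall>x. finsum A (\<lambda>y. u x y) UNIV = \<one>\<^bsub>A\<^esub>) \<and>
     (\<forall>y. finsum A (\<lambda>x. u x y) UNIV = \<one>\<^bsub>A\<^esub>)"

definition commutes_with_distances ::
    "('x::finite \<Rightarrow> 'x \<Rightarrow> real) \<Rightarrow> ('a, 'm) star_algebra_scheme \<Rightarrow> ('x \<Rightarrow> 'x \<Rightarrow> 'a) \<Rightarrow> bool" where
  "commutes_with_distances d A u \<longleftrightarrow>
     (\<forall>x y. finsum A (\<lambda>z. complex_of_real (d z y) \<odot>\<^bsub>A\<^esub> u x z) UNIV =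
            finsum A (\<lambda>z. complex_of_real (d x z) \<odot>\<^bsub>A\<^esub> u z y) UNIV)"

definition banica_relations :: "('x::finite \<Rightarrow> 'x \<Rightarrow> real) \<Rightarrow> 'x matrix_relations" where
  "banica_relations d A u \<longleftrightarrow> magic_unitary A u \<and> commutes_with_distances d A u"

definition banica_quantum_isometry_group ::
    "('x::finite \<Rightarrow> 'x \<Rightarrow> real) \<Rightarrow> 'x univ_elem cqg" where
  "banica_quantum_isometry_group d =
     matrix_quantum_group (universal_cstar_algebra (banica_relations d))
       (universal_matrix (banica_relations d))"


section \<open>Finite-dimensional W*-quantum metric spaces\<close>

text \<open>
  A finite-dimensional algebra \<open>M\<close> with trace \<open>\<psi>\<close> and a family \<open>e\<close> that is an orthonormal basis of
  \<open>L\<^sup>2(M)\<close>, the space \<open>M\<close> with inner product \<open>\<langle>a, b\<rangle> = \<psi> (b\<^sup>* a)\<close>. Operators on \<open>L\<^sup>2(M)\<close> are given by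
  their matrices \<open>T $ i $ j = \<langle>T e\<^sub>j, e\<^sub>i\<rangle>\<close>, and \<open>M\<close> acts by left multiplication.
\<close>

definition coord ::
    "('m, 'r) star_algebra_scheme \<Rightarrow> ('m \<Rightarrow> complex) \<Rightarrow> ('j \<Rightarrow> 'm) \<Rightarrow> 'm \<Rightarrow> 'j \<Rightarrow> complex" where
  "coord M \<psi> e a j = \<psi> (star M (e j) \<otimes>\<^bsub>M\<^esub> a)"

definition orthonormal_basis ::
    "('m, 'r) star_algebra_scheme \<Rightarrow> ('m \<Rightarrow> complex) \<Rightarrow> ('j::finite \<Rightarrow> 'm) \<Rightarrow> bool" where
  "orthonormal_basis M \<psi> e \<longleftrightarrow>
     range e \<subseteq> carrier M \<and>
     (\<forall>i j. coord M \<psi> e (e i) j = (if i = j then 1 else 0)) \<and>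
     (\<forall>a\<in>carrier M. a = finsum M (\<lambda>j. coord M \<psi> e a j \<odot>\<^bsub>M\<^esub> e j) UNIV)"

definition left_mult_matrix ::
    "('m, 'r) star_algebra_scheme \<Rightarrow> ('m \<Rightarrow> complex) \<Rightarrow> ('j::finite \<Rightarrow> 'm) \<Rightarrow> 'm \<Rightarrow> complex^'j^'j" where
  "left_mult_matrix M \<psi> e a = (\<chi> i j. coord M \<psi> e (a \<otimes>\<^bsub>M\<^esub> e j) i)"

definition adjoint_matrix :: "complex^'j^'j \<Rightarrow> complex^'j^'j::finite" where
  "adjoint_matrix T = (\<chi> i j. cnj (T $ j $ i))"

text \<open>In finite dimension every linear subspace of operators is weak*-closed.\<close>

definition operator_system :: "(complex^'j^'j::finite) set \<Rightarrow> bool" where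
  "operator_system W \<longleftrightarrow>
     mat 1 \<in> W \<and> (\<forall>S\<in>W. \<forall>T\<in>W. S + T \<in> W) \<and>
     (\<forall>c. \<forall>T\<in>W. (\<chi> i j. c * T $ i $ j) \<in> W) \<and> (\<forall>T\<in>W. adjoint_matrix T \<in> W)"

definition W_star_quantum_metric ::
    "('m, 'r) star_algebra_scheme \<Rightarrow> ('m \<Rightarrow> complex) \<Rightarrow> ('j::finite \<Rightarrow> 'm) \<Rightarrow>
     (real \<Rightarrow> (complex^'j^'j) set) \<Rightarrow> bool" where
  "W_star_quantum_metric M \<psi> e V \<longleftrightarrow>
     (\<forall>t\<ge>0. operator_system (V t)) \<and>
     (\<forall>s\<ge>0. \<forall>t\<ge>0. \<forall>S\<in>V s. \<forall>T\<in>V t. S ** T \<in> V (s + t)) \<and>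
     (\<forall>t\<ge>0. V t = (\<Inter>s\<in>{t<..}. V s)) \<and>
     V 0 = {T. \<forall>a\<in>carrier M. T ** left_mult_matrix M \<psi> e a = left_mult_matrix M \<psi> e a ** T}"

text \<open>
  \<open>M \<otimes> A\<close> for finite-dimensional \<open>M\<close>: the function \<open>a\<close> stands for \<open>\<Sum>\<^sub>k e\<^sub>k \<otimes> a\<^sub>k\<close>.
\<close>

definition fd_tensor ::
    "('m, 'r) star_algebra_scheme \<Rightarrow> ('m \<Rightarrow> complex) \<Rightarrow> ('j::finite \<Rightarrow> 'm) \<Rightarrow>
     ('a, 's) star_algebra_scheme \<Rightarrow> ('j \<Rightarrow> 'a) star_algebra" where
  "fd_tensor M \<psi> e A =
     \<lparr>carrier = {a. range a \<subseteq> carrier A},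
      monoid.mult = (\<lambda>a b i. finsum A (\<lambda>(k, l). coord M \<psi> e (e k \<otimes>\<^bsub>M\<^esub> e l) i \<odot>\<^bsub>A\<^esub> (a k \<otimes>\<^bsub>A\<^esub> b l)) UNIV),
      one = (\<lambda>i. coord M \<psi> e \<one>\<^bsub>M\<^esub> i \<odot>\<^bsub>A\<^esub> \<one>\<^bsub>A\<^esub>),
      zero = (\<lambda>_. \<zero>\<^bsub>A\<^esub>),
      add = (\<lambda>a b i. a i \<oplus>\<^bsub>A\<^esub> b i),
      module.smult = (\<lambda>c a i. c \<odot>\<^bsub>A\<^esub> a i),
      star = (\<lambda>a i. finsum A (\<lambda>k. coord M \<psi> e (star M (e k)) i \<odot>\<^bsub>A\<^esub> star A (a k)) UNIV)\<rparr>"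

definition unitary_matrix ::
    "('a, 's) star_algebra_scheme \<Rightarrow> ('j::finite \<Rightarrow> 'j \<Rightarrow> 'a) \<Rightarrow> bool" where
  "unitary_matrix A u \<longleftrightarrow>
     (\<forall>i j. u i j \<in> carrier A) \<and>
     (\<forall>i j. finsum A (\<lambda>k. u i k \<otimes>\<^bsub>A\<^esub> star A (u j k)) UNIV = (if i = j then \<one>\<^bsub>A\<^esub> else \<zero>\<^bsub>A\<^esub>)) \<and>
     (\<forall>i j. finsum A (\<lambda>k. star A (u k i) \<otimes>\<^bsub>A\<^esub> u k j) UNIV = (if i = j then \<one>\<^bsub>A\<^esub> else \<zero>\<^bsub>A\<^esub>))"

text \<open>The linear map with \<open>e\<^sub>j \<mapsto> \<Sum>\<^sub>k e\<^sub>k \<otimes> u\<^sub>k\<^sub>j\<close>.\<close>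

definition coaction ::
    "('m, 'r) star_algebra_scheme \<Rightarrow> ('m \<Rightarrow> complex) \<Rightarrow> ('j::finite \<Rightarrow> 'm) \<Rightarrow>
     ('a, 's) star_algebra_scheme \<Rightarrow> ('j \<Rightarrow> 'j \<Rightarrow> 'a) \<Rightarrow> 'm \<Rightarrow> ('j \<Rightarrow> 'a)" where
  "coaction M \<psi> e A u a = (\<lambda>k. finsum A (\<lambda>j. coord M \<psi> e a j \<odot>\<^bsub>A\<^esub> u k j) UNIV)"

text \<open>\<open>(\<psi> \<otimes> id)(\<delta>(a)) = \<psi>(a) 1\<close>\<close>

definition trace_preserving ::
    "('m, 'r) star_algebra_scheme \<Rightarrow> ('m \<Rightarrow> complex) \<Rightarrow> ('j::finite \<Rightarrow> 'm) \<Rightarrow>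
     ('a, 's) star_algebra_scheme \<Rightarrow> ('m \<Rightarrow> ('j \<Rightarrow> 'a)) \<Rightarrow> bool" where
  "trace_preserving M \<psi> e A \<delta> \<longleftrightarrow>
     (\<forall>a\<in>carrier M. finsum A (\<lambda>k. \<psi> (e k) \<odot>\<^bsub>A\<^esub> \<delta> a k) UNIV = \<psi> a \<odot>\<^bsub>A\<^esub> \<one>\<^bsub>A\<^esub>)"

text \<open>The matrix \<open>U (T \<otimes> 1) U\<^sup>*\<close> over \<open>A\<close>.\<close>

definition conj_matrix ::
    "('a, 's) star_algebra_scheme \<Rightarrow> ('j::finite \<Rightarrow> 'j \<Rightarrow> 'a) \<Rightarrow> complex^'j^'j \<Rightarrow> 'j \<Rightarrow> 'j \<Rightarrow> 'a" where
  "conj_matrix A u T i j =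
     finsum A (\<lambda>(k, l). T $ k $ l \<odot>\<^bsub>A\<^esub> (u i k \<otimes>\<^bsub>A\<^esub> star A (u j l))) UNIV"

text \<open>\<open>W \<otimes> A\<close> as a space of matrices over \<open>A\<close>: all finite sums \<open>\<Sum>\<^sub>r S\<^sub>r \<otimes> a\<^sub>r\<close> with \<open>S\<^sub>r \<in> W\<close>.\<close>

definition space_tensor ::
    "(complex^'j^'j::finite) set \<Rightarrow> ('a, 's) star_algebra_scheme \<Rightarrow> ('j \<Rightarrow> 'j \<Rightarrow> 'a) set" where
  "space_tensor W A =
     {\<lambda>i j. finsum A (\<lambda>r. S r $ i $ j \<odot>\<^bsub>A\<^esub> a r) {..<N} | (N::nat) S a.
        (\<forall>r<N. S r \<in> W) \<and> (\<forall>r<N. a r \<in> carrier A)}"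

definition W_star_isometry_relations ::
    "('m, 'r) star_algebra_scheme \<Rightarrow> ('m \<Rightarrow> complex) \<Rightarrow> ('j::finite \<Rightarrow> 'm) \<Rightarrow>
     (real \<Rightarrow> (complex^'j^'j) set) \<Rightarrow> 'j matrix_relations" where
  "W_star_isometry_relations M \<psi> e V A u \<longleftrightarrow>
     unitary_matrix A u \<and>
     unital_star_hom M (fd_tensor M \<psi> e A) (coaction M \<psi> e A u) \<and>
     trace_preserving M \<psi> e A (coaction M \<psi> e A u) \<and>
     (\<forall>t\<ge>0. \<forall>T\<in>V t. conj_matrix A u T \<in> space_tensor (V t) A)"

definition W_star_quantum_isometry_group ::
    "('m, 'r) star_algebra_scheme \<Rightarrow> ('m \<Rightarrow> complex) \<Rightarrow> ('j::finite \<Rightarrow> 'm) \<Rightarrow>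
     (real \<Rightarrow> (complex^'j^'j) set) \<Rightarrow> 'j univ_elem cqg" where
  "W_star_quantum_isometry_group M \<psi> e V =
     matrix_quantum_group (universal_cstar_algebra (W_star_isometry_relations M \<psi> e V))
       (universal_matrix (W_star_isometry_relations M \<psi> e V))"


section \<open>The W*-quantum metric space of a finite metric space\<close>

definition linf :: "('x::finite \<Rightarrow> complex) star_algebra" where
  "linf =
     \<lparr>carrier = UNIV, monoid.mult = (\<lambda>f g x. f x * g x), one = (\<lambda>_. 1), zero = (\<lambda>_. 0),
      add = (\<lambda>f g x. f x + g x), module.smult = (\<lambda>c f x. c * f x), star = (\<lambda>f x. cnj (f x))\<rparr>"

definition uniform_trace :: "('x::finite \<Rightarrow> complex) \<Rightarrow> complex" where
  "uniform_trace f = (\<Sum>x\<in>UNIV. f x) / of_nat CARD('x)"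

text \<open>
  The indicator functions of points, normalised in \<open>L\<^sup>2\<close> of the uniform trace.
\<close>

definition point_basis :: "'x::finite \<Rightarrow> 'x \<Rightarrow> complex" where
  "point_basis x = (\<lambda>y. if y = x then complex_of_real (sqrt (real CARD('x))) else 0)"

definition metric_filtration ::
    "('x::finite \<Rightarrow> 'x \<Rightarrow> real) \<Rightarrow> real \<Rightarrow> (complex^'x^'x) set" where
  "metric_filtration d t = {A. \<forall>x y. d x y > t \<longrightarrow> A $ x $ y = 0}"

lemma linf_simps:
  "carrier linf = UNIV" "f \<otimes>\<^bsub>linf\<^esub> g = (\<lambda>x. f x * g x)" "f \<oplus>\<^bsub>linf\<^esub> g = (\<lambda>x. f x + g x)"
  "\<zero>\<^bsub>linf\<^esub> = (\<lambda>_. 0)" "c \<odot>\<^bsub>linf\<^esub> f = (\<lambda>x. c * f x)" "star linf f = (\<lambda>x. cnj (f x))"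
  by (simp_all add: linf_def)

lemma finsum_linf: "finsum linf F S = (\<lambda>x. \<Sum>i\<in>S. F i x)" if "finite S"
proof -
  interpret abelian_monoid linf
    by (intro abelian_monoidI) (auto simp: linf_simps algebra_simps)
  show ?thesis
    using that by induction (auto simp: linf_simps)
qed

lemma coord_linf:
  "coord linf uniform_trace point_basis f x = f x / complex_of_real (sqrt (real CARD('x)))"
  for f :: "'x::finite \<Rightarrow> complex"
proof -
  let ?r = "complex_of_real (sqrt (real CARD('x)))"
  have sq: "?r * ?r = of_nat CARD('x)"
    by (metis of_nat_0_le_iff of_real_mult of_real_of_nat_eq real_sqrt_mult_self abs_of_nonneg)
  have "coord linf uniform_trace point_basis f x = ?r * f x / of_nat CARD('x)"
    by (simp add: coord_def uniform_trace_def linf_simps point_basis_def if_distrib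
        [of cnj] if_distrib [of "\<lambda>z. z * _"] sum.delta cong: if_cong)
  also have "\<dots> = f x / ?r"
    unfolding sq[symmetric] by simp
  finally show ?thesis .
qed

lemma orthonormal_basis_point_basis:
  "orthonormal_basis linf uniform_trace (point_basis :: 'x::finite \<Rightarrow> _)"
  by (auto simp: orthonormal_basis_def coord_linf finsum_linf linf_simps point_basis_def fun_eq_iff
      if_distrib [of "\<lambda>z. _ * z"] sum.delta' cong: if_cong)

lemma left_mult_matrix_linf:
  "left_mult_matrix linf uniform_trace point_basis f = (\<chi> x y. if x = y then f x else 0)"
  by (auto simp: left_mult_matrix_def coord_linf linf_simps point_basis_def vec_eq_iff)

lemma W_star_quantum_metric_metric_filtration:
  fixes d :: "'x::finite \<Rightarrow> 'x \<Rightarrow> real"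
  assumes "Metric_space UNIV d"
  shows "W_star_quantum_metric linf uniform_trace point_basis (metric_filtration d)"
proof -
  interpret Metric_space UNIV d by fact
  have "operator_system (metric_filtration d t)" if "t \<ge> 0" for t
    using that commute by (auto simp: operator_system_def metric_filtration_def mat_def adjoint_matrix_def)
  moreover have "S ** T \<in> metric_filtration d (s + t)"
    if "S \<in> metric_filtration d s" "T \<in> metric_filtration d t" for s t S T
  proof -
    have "S $ x $ z * T $ z $ y = 0" if "d x y > s + t" for x y z
    proof -
      have "d x z > s \<or> d z y > t"
        using that triangle[of x z y] by auto
      then show ?thesis
        using \<open>S \<in> _\<close> \<open>T \<in> _\<close> by (auto simp: metric_filtration_def)
    qed
    then have "(\<Sum>z\<in>UNIV. S $ x $ z * T $ z $ y) = 0" if "d x y > s + t" for x y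
      using that by (intro sum.neutral) blast
    then show ?thesis
      by (simp add: metric_filtration_def matrix_matrix_mult_def)
  qed
  moreover have "metric_filtration d t = (\<Inter>s\<in>{t<..}. metric_filtration d s)" for t
  proof
    show "metric_filtration d t \<subseteq> (\<Inter>s\<in>{t<..}. metric_filtration d s)"
      by (auto simp: metric_filtration_def)
    show "(\<Inter>s\<in>{t<..}. metric_filtration d s) \<subseteq> metric_filtration d t"
    proof
      fix A assume A: "A \<in> (\<Inter>s\<in>{t<..}. metric_filtration d s)"
      have "A $ x $ y = 0" if xy: "d x y > t" for x y
      proof -
        obtain s where s: "t < s" "s < d x y"
          using dense xy by blast
        then have "A \<in> metric_filtration d s"
          using A by auto
        then show ?thesis
          using s by (simp add: metric_filtration_def)
      qed
      then show "A \<in> metric_filtration d t"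
        by (simp add: metric_filtration_def)
    qed
  qed
  moreover have "metric_filtration d 0 =
      {T. \<forall>f\<in>carrier linf. T ** left_mult_matrix linf uniform_trace point_basis f =
             left_mult_matrix linf uniform_trace point_basis f ** T}"
  proof -
    have "T \<in> metric_filtration d 0 \<longleftrightarrow> (\<forall>f. \<forall>x y. T $ x $ y * f y = f x * T $ x $ y)" for T
    proof
      assume "T \<in> metric_filtration d 0"
      then have "T $ x $ y = 0" if "x \<noteq> y" for x y
        using that mdist_pos_less[of x y] by (simp add: metric_filtration_def)
      then show "\<forall>f. \<forall>x y. T $ x $ y * f y = f x * T $ x $ y"
        by (metis mult.commute mult_zero_left mult_zero_right)
    next
      assume *: "\<forall>f. \<forall>x y. T $ x $ y * f y = f x * T $ x $ y"
      have "T $ x $ y = 0" if "d x y > 0" for x y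
        using *[rule_format, of x y "\<lambda>z. if z = x then 1 else 0"] that
        by (cases "x = y") auto
      then show "T \<in> metric_filtration d 0"
        by (simp add: metric_filtration_def)
    qed
    then show ?thesis
      by (auto simp: left_mult_matrix_linf linf_simps vec_eq_iff matrix_matrix_mult_def
          if_distrib [of "\<lambda>z. _ * z"] if_distrib [of "\<lambda>z. z * _"] sum.delta sum.delta' cong: if_cong)
  qed
  ultimately show ?thesis
    unfolding W_star_quantum_metric_def by blast
qed

end

theory Submission
  imports Defs
begin

text \<open>
  The two quantum groups are universal for relations on a matrix \<open>u\<close> over a C*-algebra, and the two
  sets of relations are equivalent over every pre-C*-algebra
  (\<open>W_star_isometry_relations_iff_banica_relations\<close>). Hence both universal C*-algebras arise from the
  same seminorms on the free *-algebra, and the two quantum groups coincide, together with their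
  generators and comultiplications; the isomorphism is the identity.

  That \<open>u\<close> is unitary and induces a trace preserving unital *-homomorphism on the functions on \<open>X\<close>
  says exactly that \<open>u\<close> is a magic unitary (\<open>magic_unitary_iff_coaction\<close>). For magic unitaries,
  preservation of the filtration says \<open>u\<^sub>i\<^sub>k u\<^sub>j\<^sub>l = 0\<close> whenever \<open>d(k, l) < d(i, j)\<close>
  (\<open>conj_matrix_preserves_metric_filtration_iff\<close>), while commutation with the distance matrix says
  \<open>u\<^sub>i\<^sub>k u\<^sub>j\<^sub>l = 0\<close> whenever \<open>d(k, l) \<noteq> d(i, j)\<close> (\<open>commutes_with_distances_iff\<close>). The first condition
  implies the second because the products \<open>u\<^sub>i\<^sub>k u\<^sub>j\<^sub>l u\<^sub>i\<^sub>k\<close> are positive and their average change of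
  distance is zero (\<open>intertwines_distances_of_strict\<close>).

  All uses of positivity, including the orthogonality of projections with sum 1, rest on one
  fact: a vanishing sum of positive elements has vanishing terms (\<open>corner_positive_sum_zero\<close>). It is
  derived from the C*-identity by an elementary argument: the unit is an extreme point of the
  unit ball (\<open>corner_extreme_point\<close>). The rest is the verification that the completion of the
  free *-algebra for a C*-seminorm is a normed *-algebra with the C*-identity
  (\<open>pre_cstar_algebra_completion\<close>).
\<close>

section \<open>Abstract *-algebras and pre-C*-algebras\<close>

locale unital_star_algebra = ring A for A :: "('a, 'm) star_algebra_scheme" (structure) +
  assumes smult_closed [simp, intro]: "a \<in> carrier A \<Longrightarrow> c \<odot> a \<in> carrier A"
    and smult_scalar_add: "a \<in> carrier A \<Longrightarrow> (c + d) \<odot> a = c \<odot> a \<oplus> d \<odot> a"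
    and smult_add: "a \<in> carrier A \<Longrightarrow> b \<in> carrier A \<Longrightarrow> c \<odot> (a \<oplus> b) = c \<odot> a \<oplus> c \<odot> b"
    and smult_smult [simp]: "a \<in> carrier A \<Longrightarrow> c \<odot> (d \<odot> a) = (c * d) \<odot> a"
    and smult_one [simp]: "a \<in> carrier A \<Longrightarrow> 1 \<odot> a = a"
    and mult_smult_left [simp]:
      "a \<in> carrier A \<Longrightarrow> b \<in> carrier A \<Longrightarrow> (c \<odot> a) \<otimes> b = c \<odot> (a \<otimes> b)"
    and mult_smult_right [simp]:
      "a \<in> carrier A \<Longrightarrow> b \<in> carrier A \<Longrightarrow> a \<otimes> (c \<odot> b) = c \<odot> (a \<otimes> b)"
    and star_closed [simp, intro]: "a \<in> carrier A \<Longrightarrow> star A a \<in> carrier A"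
    and star_star [simp]: "a \<in> carrier A \<Longrightarrow> star A (star A a) = a"
    and star_add: "a \<in> carrier A \<Longrightarrow> b \<in> carrier A \<Longrightarrow> star A (a \<oplus> b) = star A a \<oplus> star A b"
    and star_mult: "a \<in> carrier A \<Longrightarrow> b \<in> carrier A \<Longrightarrow> star A (a \<otimes> b) = star A b \<otimes> star A a"
    and star_smult: "a \<in> carrier A \<Longrightarrow> star A (c \<odot> a) = cnj c \<odot> star A a"
begin

lemma smult_zero_left [simp]: "a \<in> carrier A \<Longrightarrow> 0 \<odot> a = \<zero>"
  using smult_scalar_add[of a 0 0] by simp

lemma smult_zero_right [simp]: "c \<odot> \<zero> = \<zero>"
  using smult_smult[of \<zero> c 0] smult_zero_left[of \<zero>] by simp

lemma smult_minus_one [simp]: "a \<in> carrier A \<Longrightarrow> (-1) \<odot> a = \<ominus> a"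
  using smult_scalar_add[of a "-1" 1] by (simp add: minus_equality)

lemma minus_conv_smult: "a \<in> carrier A \<Longrightarrow> b \<in> carrier A \<Longrightarrow> a \<ominus> b = a \<oplus> (-1) \<odot> b"
  by (simp add: a_minus_def)

lemma smult_cancel: "a \<in> carrier A \<Longrightarrow> c \<odot> a = \<zero> \<Longrightarrow> c \<noteq> 0 \<Longrightarrow> a = \<zero>"
  using smult_smult[of a "inverse c" c] by simp

lemma star_zero [simp]: "star A \<zero> = \<zero>"
  using star_smult[of \<zero> 0] by simp

lemma star_one [simp]: "star A \<one> = \<one>"
  using star_mult[of "star A \<one>" \<one>] by simp

lemma smult_finsum:
  "f \<in> S \<rightarrow> carrier A \<Longrightarrow> c \<odot> finsum A f S = finsum A (\<lambda>i. c \<odot> f i) S"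
proof (induction S rule: infinite_finite_induct)
  case (insert i S)
  then show ?case
    by (subst (1 2) finsum_insert) (auto simp: smult_add Pi_iff)
qed simp_all

lemma star_finsum:
  "f \<in> S \<rightarrow> carrier A \<Longrightarrow> star A (finsum A f S) = finsum A (\<lambda>i. star A (f i)) S"
proof (induction S rule: infinite_finite_induct)
  case (insert i S)
  then show ?case
    by (subst (1 2) finsum_insert) (auto simp: star_add Pi_iff)
qed simp_all

lemma finsum_scalar:
  "a \<in> carrier A \<Longrightarrow> finite S \<Longrightarrow> finsum A (\<lambda>i. c i \<odot> a) S = (\<Sum>i\<in>S. c i) \<odot> a"
  by (induction S rule: infinite_finite_induct) (auto simp: smult_scalar_add finsum_insert Pi_iff)

lemma finsum_only:
  assumes "finite S" "i \<in> S" "f i \<in> carrier A" "\<And>j. j \<in> S \<Longrightarrow> j \<noteq> i \<Longrightarrow> f j = \<zero>"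
  shows "finsum A f S = f i"
proof -
  have "finsum A f (insert i (S - {i})) = f i \<oplus> finsum A f (S - {i})"
    using assms by (intro finsum_insert) (auto simp: Pi_iff)
  moreover have "finsum A f (S - {i}) = \<zero>"
    using assms by (intro add.finprod_one_eqI) auto
  ultimately show ?thesis
    using assms by (simp add: insert_absorb)
qed

lemma finsum_swap:
  assumes "finite S" "finite T" "\<And>i j. i \<in> S \<Longrightarrow> j \<in> T \<Longrightarrow> f i j \<in> carrier A"
  shows "finsum A (\<lambda>i. finsum A (f i) T) S = finsum A (\<lambda>j. finsum A (\<lambda>i. f i j) S) T"
  using assms(1,3)
proof (induction S)
  case (insert i S)
  have "finsum A (\<lambda>j. finsum A (\<lambda>i. f i j) (insert i S)) T =
      finsum A (\<lambda>j. f i j \<oplus> finsum A (\<lambda>i. f i j) S) T"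
    using insert by (intro finsum_cong') (auto simp: finsum_insert Pi_iff intro!: finsum_closed)
  also have "\<dots> = finsum A (f i) T \<oplus> finsum A (\<lambda>j. finsum A (\<lambda>i. f i j) S) T"
    using insert by (intro finsum_addf) (auto intro!: finsum_closed)
  finally show ?case
    using insert by (simp add: finsum_insert Pi_iff finsum_closed)
qed simp

end

locale pre_cstar_algebra = unital_star_algebra A for A :: "('a, 'm) cstar_algebra_scheme" (structure) +
  assumes cstar_nrm: "cstar_seminorm A (nrm A)"
    and nrm_zero_imp: "a \<in> carrier A \<Longrightarrow> nrm A a = 0 \<Longrightarrow> a = \<zero>"
begin

lemma nrm_ge_0: "a \<in> carrier A \<Longrightarrow> 0 \<le> nrm A a"
  and nrm_add: "a \<in> carrier A \<Longrightarrow> b \<in> carrier A \<Longrightarrow> nrm A (a \<oplus> b) \<le> nrm A a + nrm A b"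
  and nrm_smult: "a \<in> carrier A \<Longrightarrow> nrm A (c \<odot> a) = cmod c * nrm A a"
  and nrm_mult: "a \<in> carrier A \<Longrightarrow> b \<in> carrier A \<Longrightarrow> nrm A (a \<otimes> b) \<le> nrm A a * nrm A b"
  and nrm_star_mult: "a \<in> carrier A \<Longrightarrow> nrm A (star A a \<otimes> a) = (nrm A a)\<^sup>2"
  using cstar_nrm by (auto simp: cstar_seminorm_def)

end

section \<open>Positivity in corners\<close>

context pre_cstar_algebra
begin

definition projection :: "'a \<Rightarrow> bool" where
  "projection p \<longleftrightarrow> p \<in> carrier A \<and> star A p = p \<and> p \<otimes> p = p"

lemma projectionD [simp]:
  assumes "projection p"
  shows "p \<in> carrier A" "star A p = p" "p \<otimes> p = p"
  using assms by (auto simp: projection_def)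

lemma nrm_projection_le_1:
  assumes "projection p"
  shows "nrm A p \<le> 1"
proof (rule ccontr)
  assume "\<not> nrm A p \<le> 1"
  moreover have "nrm A p = nrm A p * nrm A p"
    using nrm_star_mult[of p] assms by (simp add: power2_eq_square)
  ultimately show False
    by (metis mult_cancel_left1 less_irrefl not_le zero_le_one)
qed

text \<open>
  The self-adjoint part of the corner \<open>pAp\<close>, in which the projection \<open>p\<close> is the unit.
\<close>

definition corner_selfadjoint :: "'a \<Rightarrow> 'a \<Rightarrow> bool" where
  "corner_selfadjoint p x \<longleftrightarrow> x \<in> carrier A \<and> star A x = x \<and> p \<otimes> x = x \<and> x \<otimes> p = x"

lemma corner_selfadjointD:
  assumes "corner_selfadjoint p x"
  shows "x \<in> carrier A" "star A x = x" "p \<otimes> x = x" "x \<otimes> p = x"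
  using assms by (auto simp: corner_selfadjoint_def)

lemma corner_selfadjoint_smult:
  assumes "projection p" "corner_selfadjoint p x"
  shows "corner_selfadjoint p (complex_of_real c \<odot> x)"
  using assms by (simp add: corner_selfadjoint_def star_smult)

lemma corner_selfadjoint_add:
  assumes "projection p" "corner_selfadjoint p x" "corner_selfadjoint p y"
  shows "corner_selfadjoint p (x \<oplus> y)"
  using assms by (simp add: corner_selfadjoint_def star_add l_distr r_distr)

text \<open>
  Products of affine expressions in \<open>x\<close> over the corner unit are quadratic expressions in \<open>x\<close>. The
  coefficients of \<open>p\<close> are written out, even if they are 1, so that equations between such
  expressions reduce to equations between complex coefficients.
\<close>

lemma corner_linear_mult:
  assumes "projection p" "corner_selfadjoint p x"
  shows "(a \<odot> p \<oplus> b \<odot> x) \<otimes> (c \<odot> p \<oplus> d \<odot> x) =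
    (a * c) \<odot> p \<oplus> (a * d + b * c) \<odot> x \<oplus> (b * d) \<odot> (x \<otimes> x)"
  using assms corner_selfadjointD[OF assms(2)]
  by (simp add: l_distr r_distr smult_scalar_add a_ac mult_ac smult_add)

lemma lin_comb_collect:
  assumes "x \<in> carrier A" "y \<in> carrier A" "z \<in> carrier A"
  shows "s \<odot> (a \<odot> x \<oplus> b \<odot> y \<oplus> c \<odot> z) \<oplus> t \<odot> (a' \<odot> x \<oplus> b' \<odot> y \<oplus> c' \<odot> z) =
    (s * a + t * a') \<odot> x \<oplus> (s * b + t * b') \<odot> y \<oplus> (s * c + t * c') \<odot> z"
  using assms by (simp add: smult_scalar_add smult_add a_ac)

lemma nrm_mult_self_le_1: "a \<in> carrier A \<Longrightarrow> nrm A a \<le> 1 \<Longrightarrow> nrm A (a \<otimes> a) \<le> 1"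
  using nrm_mult[of a a] nrm_ge_0[of a] mult_mono[of "nrm A a" 1 "nrm A a" 1] by auto

lemma nrm_convex_le_1:
  assumes "a \<in> carrier A" "b \<in> carrier A" "nrm A a \<le> 1" "nrm A b \<le> 1"
    "0 \<le> s" "0 \<le> t" "s + t = 1"
  shows "nrm A (complex_of_real s \<odot> a \<oplus> complex_of_real t \<odot> b) \<le> 1"
proof -
  have "nrm A (complex_of_real s \<odot> a \<oplus> complex_of_real t \<odot> b) \<le> s * nrm A a + t * nrm A b"
    using assms nrm_add[of "complex_of_real s \<odot> a" "complex_of_real t \<odot> b"] by (simp add: nrm_smult)
  also have "\<dots> \<le> s * 1 + t * 1"
    using assms by (intro add_mono mult_left_mono) auto
  finally show ?thesis using assms by simp
qed

text \<open>
  Let \<open>w = exp(i\<pi>/4)\<close> and let \<open>v\<close> be its conjugate. The quadratic terms in \<open>(p + wx)\<^sup>2\<close> and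
  \<open>(p + vx)\<^sup>2\<close> cancel, because \<open>w\<^sup>2 + v\<^sup>2 = 0\<close>, so the average of these two squares is \<open>p + \<surd>2 x\<close>.
  Both squares lie in the unit ball: \<open>(p + vx)(p + wx) = p + \<surd>2 x + x\<^sup>2\<close> is a convex combination of
  \<open>(p + x)\<^sup>2\<close> and \<open>(p - x)\<^sup>2\<close>, and by the C*-identity its norm is the square of the norms of
  \<open>p + wx\<close> and \<open>p + vx\<close>.
\<close>

lemma unit_ball_corner_step:
  assumes p: "projection p" and x: "corner_selfadjoint p x"
    and le: "nrm A (p \<oplus> x) \<le> 1" "nrm A (p \<oplus> (-1) \<odot> x) \<le> 1"
  shows "nrm A (p \<oplus> complex_of_real (sqrt 2) \<odot> x) \<le> 1"
proof -
  note [simp] = corner_selfadjointD[OF x] p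
  let ?r = "complex_of_real (sqrt 2)"
  define w where "w = Complex (sqrt 2 / 2) (sqrt 2 / 2)"
  have rr: "?r * ?r = 2"
    by (simp flip: of_real_mult)
  have w: "w + cnj w = ?r" "w * cnj w = 1" "w * w + cnj w * cnj w = 0"
    by (auto simp: w_def complex_eq_iff)
  have sq: "nrm A ((1 \<odot> p \<oplus> c \<odot> x) \<otimes> (1 \<odot> p \<oplus> c \<odot> x)) \<le> 1"
    if c: "c + cnj c = ?r" "c * cnj c = 1" for c
  proof -
    let ?z = "1 \<odot> p \<oplus> c \<odot> x"
    \<comment> \<open>The weight for which \<open>(p + x)\<^sup>2\<close> and \<open>(p - x)\<^sup>2\<close> average to \<open>p + \<surd>2 x + x\<^sup>2\<close>:
      it solves \<open>2\<alpha> - (2 - 2\<alpha>) = \<surd>2\<close>.\<close>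
    define \<alpha> where "\<alpha> = (2 + sqrt 2) / 4"
    have \<alpha>: "0 \<le> \<alpha>" "\<alpha> \<le> 1"
      using sqrt2_less_2 by (auto simp: \<alpha>_def)
    have "star A ?z = 1 \<odot> p \<oplus> cnj c \<odot> x"
      by (simp add: star_add star_smult)
    then have "star A ?z \<otimes> ?z = 1 \<odot> p \<oplus> ?r \<odot> x \<oplus> 1 \<odot> (x \<otimes> x)"
      using corner_linear_mult[OF p x, of 1 "cnj c" 1 c] c by (simp add: mult_ac)
    also have "\<dots> = complex_of_real \<alpha> \<odot> ((1 \<odot> p \<oplus> 1 \<odot> x) \<otimes> (1 \<odot> p \<oplus> 1 \<odot> x)) \<oplus>
        complex_of_real (1 - \<alpha>) \<odot> ((1 \<odot> p \<oplus> (-1) \<odot> x) \<otimes> (1 \<odot> p \<oplus> (-1) \<odot> x))"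
      unfolding corner_linear_mult[OF p x] by (subst lin_comb_collect) (auto simp: \<alpha>_def field_simps)
    also have "nrm A \<dots> \<le> 1"
      using le \<alpha> by (intro nrm_convex_le_1 nrm_mult_self_le_1) auto
    finally have "(nrm A ?z)\<^sup>2 \<le> 1"
      by (subst nrm_star_mult[symmetric]) auto
    then have "nrm A ?z \<le> 1"
      using abs_square_le_1 nrm_ge_0[of ?z] by fastforce
    then show ?thesis
      by (intro nrm_mult_self_le_1) auto
  qed
  have "complex_of_real (1/2) \<odot> ((1 \<odot> p \<oplus> w \<odot> x) \<otimes> (1 \<odot> p \<oplus> w \<odot> x)) \<oplus>
      complex_of_real (1/2) \<odot> ((1 \<odot> p \<oplus> cnj w \<odot> x) \<otimes> (1 \<odot> p \<oplus> cnj w \<odot> x)) =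
      1 \<odot> p \<oplus> ?r \<odot> x \<oplus> 0 \<odot> (x \<otimes> x)"
    unfolding corner_linear_mult[OF p x] using w 
    by (subst lin_comb_collect) (auto simp: field_simps simp flip: distrib_left)
  moreover have "nrm A (complex_of_real (1/2) \<odot> ((1 \<odot> p \<oplus> w \<odot> x) \<otimes> (1 \<odot> p \<oplus> w \<odot> x)) \<oplus>
      complex_of_real (1/2) \<odot> ((1 \<odot> p \<oplus> cnj w \<odot> x) \<otimes> (1 \<odot> p \<oplus> cnj w \<odot> x))) \<le> 1"
    using w by (intro nrm_convex_le_1 sq) (auto simp: add_ac mult_ac)
  ultimately show ?thesis by simp
qed

text \<open>
  The unit of a corner is an extreme point of the unit ball: by the previous lemma \<open>x\<close> can be scaled
  by \<open>\<surd>2\<close> again and again without leaving the ball, while \<open>p + y\<close> in the ball forces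
  \<open>\<parallel>y\<parallel> \<le> 2\<close>.
\<close>

lemma corner_extreme_point:
  assumes p: "projection p" and x: "corner_selfadjoint p x"
    and le: "nrm A (p \<oplus> x) \<le> 1" "nrm A (p \<oplus> (-1) \<odot> x) \<le> 1"
  shows "x = \<zero>"
proof -
  note [simp] = corner_selfadjointD[OF x] p
  define y where "y n = complex_of_real (sqrt 2 ^ n) \<odot> x" for n
  have y: "corner_selfadjoint p (y n)" for n
    unfolding y_def by (rule corner_selfadjoint_smult[OF p x])
  note [simp] = corner_selfadjointD(1)[OF y]
  have *: "nrm A (p \<oplus> y n) \<le> 1 \<and> nrm A (p \<oplus> (-1) \<odot> y n) \<le> 1" for n
  proof (induction n)
    case 0
    then show ?case using le by (simp add: y_def)
  next
    case (Suc n)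
    have Y: "corner_selfadjoint p ((-1) \<odot> y n)"
      using corner_selfadjoint_smult[OF p y, of "-1" n] by simp
    have "nrm A (p \<oplus> complex_of_real (sqrt 2) \<odot> y n) \<le> 1"
      by (rule unit_ball_corner_step[OF p y]) (use Suc in auto)
    moreover have "nrm A (p \<oplus> complex_of_real (sqrt 2) \<odot> ((-1) \<odot> y n)) \<le> 1"
      by (rule unit_ball_corner_step[OF p Y]) (use Suc in simp_all)
    ultimately show ?case
      by (simp add: y_def del: smult_minus_one)
  qed
  have "sqrt 2 ^ n * nrm A x \<le> 2" for n
  proof -
    have "y n = (p \<oplus> y n) \<oplus> (-1) \<odot> p"
      by (simp add: a_comm[of p] a_assoc r_neg)
    then have "nrm A (y n) \<le> nrm A (p \<oplus> y n) + nrm A ((-1) \<odot> p)"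
      using nrm_add[of "p \<oplus> y n" "(-1) \<odot> p"] by simp
    also have "\<dots> \<le> 2"
      using *[of n] nrm_projection_le_1[OF p] by (simp add: nrm_smult del: smult_minus_one)
    finally show ?thesis
      by (simp add: y_def nrm_smult norm_power)
  qed
  moreover have "\<exists>n. 2 < sqrt 2 ^ n * nrm A x" if "nrm A x > 0"
    using real_arch_pow[of "sqrt 2" "2 / nrm A x"] that by (simp add: field_simps)
  ultimately have "nrm A x = 0"
    using nrm_ge_0[of x] by (meson corner_selfadjointD(1) less_eq_real_def not_le x)
  then show ?thesis
    by (intro nrm_zero_imp) auto
qed

text \<open>
  For a self-adjoint element of a C*-algebra with unit \<open>p\<close>, having spectrum in \<open>[0, 2c]\<close> is the same as
  \<open>\<parallel>cp - x\<parallel> \<le> c\<close>. Taking this as definition of positivity makes the cone property a consequence of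
  the triangle inequality.
\<close>

definition corner_positive :: "'a \<Rightarrow> 'a \<Rightarrow> bool" where
  "corner_positive p x \<longleftrightarrow> corner_selfadjoint p x \<and>
     (\<exists>c\<ge>0. nrm A (complex_of_real c \<odot> p \<oplus> (-1) \<odot> x) \<le> c)"

lemma corner_positive_selfadjoint: "corner_positive p x \<Longrightarrow> corner_selfadjoint p x"
  by (simp add: corner_positive_def)

lemma corner_positive_closed: "corner_positive p x \<Longrightarrow> x \<in> carrier A"
  by (simp add: corner_positive_def corner_selfadjoint_def)

lemma corner_positive_larger_constant:
  assumes p: "projection p" and x: "x \<in> carrier A"
    and le: "nrm A (complex_of_real c \<odot> p \<oplus> x) \<le> c" and "c \<le> c'"
  shows "nrm A (complex_of_real c' \<odot> p \<oplus> x) \<le> c'"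
proof -
  have "complex_of_real c' \<odot> p \<oplus> x =
      complex_of_real (c' - c) \<odot> p \<oplus> (complex_of_real c \<odot> p \<oplus> x)"
    using p x by (simp add: a_assoc[symmetric] smult_scalar_add[symmetric])
  also have "nrm A \<dots> \<le> nrm A (complex_of_real (c' - c) \<odot> p) + c"
    using p x nrm_add[of "complex_of_real (c' - c) \<odot> p" "complex_of_real c \<odot> p \<oplus> x"] le by simp
  also have "nrm A (complex_of_real (c' - c) \<odot> p) \<le> c' - c"
    using p nrm_projection_le_1[OF p] \<open>c \<le> c'\<close> mult_left_mono[of "nrm A p" 1 "c' - c"]
    by (simp add: nrm_smult del: of_real_diff)
  finally show ?thesis by simp
qed

lemma corner_positive_add:
  assumes p: "projection p" and x: "corner_positive p x" and y: "corner_positive p y"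
  shows "corner_positive p (x \<oplus> y)"
proof -
  have [simp]: "x \<in> carrier A" "y \<in> carrier A"
    using x y by (auto dest: corner_positive_closed)
  obtain c d where c: "c \<ge> 0" "nrm A (complex_of_real c \<odot> p \<oplus> (-1) \<odot> x) \<le> c"
    and d: "d \<ge> 0" "nrm A (complex_of_real d \<odot> p \<oplus> (-1) \<odot> y) \<le> d"
    using x y unfolding corner_positive_def by blast
  have "complex_of_real (c + d) \<odot> p \<oplus> (-1) \<odot> (x \<oplus> y) =
     (complex_of_real c \<odot> p \<oplus> (-1) \<odot> x) \<oplus> (complex_of_real d \<odot> p \<oplus> (-1) \<odot> y)"
    using p by (simp add: smult_scalar_add smult_add minus_add a_ac)
  also have "nrm A \<dots> \<le> c + d"
    using p c d nrm_add[of "complex_of_real c \<odot> p \<oplus> (-1) \<odot> x" "complex_of_real d \<odot> p \<oplus> (-1) \<odot> y"]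
    by simp
  finally show ?thesis
    using x y c d p unfolding corner_positive_def
    by (intro conjI corner_selfadjoint_add exI[of _ "c + d"]) auto
qed

lemma corner_positive_smult:
  assumes p: "projection p" and x: "corner_positive p x" and s: "0 \<le> s"
  shows "corner_positive p (complex_of_real s \<odot> x)"
proof -
  have [simp]: "x \<in> carrier A"
    using x by (auto dest: corner_positive_closed)
  obtain c where c: "c \<ge> 0" "nrm A (complex_of_real c \<odot> p \<oplus> (-1) \<odot> x) \<le> c"
    using x unfolding corner_positive_def by blast
  have "complex_of_real (s * c) \<odot> p \<oplus> (-1) \<odot> (complex_of_real s \<odot> x) =
      complex_of_real s \<odot> (complex_of_real c \<odot> p \<oplus> (-1) \<odot> x)"
    using p by (simp add: smult_add del: smult_minus_one)
  also have "nrm A \<dots> \<le> s * c"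
    using p c s by (simp add: nrm_smult mult_left_mono del: smult_minus_one)
  finally show ?thesis
    using x s c p unfolding corner_positive_def
    by (intro conjI corner_selfadjoint_smult exI[of _ "s * c"]) auto
qed

lemma corner_positive_zero: "projection p \<Longrightarrow> corner_positive p \<zero>"
  unfolding corner_positive_def
  by (intro conjI exI[of _ 0]) (use nrm_smult[of \<zero> 0] in \<open>auto simp: corner_selfadjoint_def\<close>)

lemma corner_positive_finsum:
  assumes "projection p" "\<And>i. i \<in> S \<Longrightarrow> corner_positive p (f i)"
  shows "corner_positive p (finsum A f S)"
  using assms(2)
proof (induction S rule: infinite_finite_induct)
  case (insert i S)
  then have "finsum A f (insert i S) = f i \<oplus> finsum A f S"
    by (intro finsum_insert) (auto intro: corner_positive_closed)
  with insert show ?case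
    by (auto intro: corner_positive_add[OF assms(1)])
qed (simp_all add: corner_positive_zero[OF assms(1)])

text \<open>
  If \<open>x\<close> and \<open>-x\<close> are both positive, one constant \<open>e\<close> serves for both, and \<open>p \<plusminus> x/e\<close> are in the unit
  ball, so \<open>corner_extreme_point\<close> applies.
\<close>

lemma corner_positive_antisym:
  assumes p: "projection p" and x: "corner_positive p x" and m: "corner_positive p ((-1) \<odot> x)"
  shows "x = \<zero>"
proof -
  have [simp]: "x \<in> carrier A"
    using x by (auto dest: corner_positive_closed)
  obtain c d where c: "c \<ge> 0" "nrm A (complex_of_real c \<odot> p \<oplus> (-1) \<odot> x) \<le> c"
    and d: "d \<ge> 0" "nrm A (complex_of_real d \<odot> p \<oplus> x) \<le> d"
    using x m unfolding corner_positive_def by force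
  \<comment> \<open>The summand 1 keeps \<open>e\<close> positive, so that \<open>x\<close> can be divided by it.\<close>
  define e where "e = max c d + 1"
  have e: "e > 0" "c \<le> e" "d \<le> e"
    using c d by (auto simp: e_def)
  define y where "y = complex_of_real (1 / e) \<odot> x"
  have scale: "nrm A (p \<oplus> complex_of_real (1 / e) \<odot> z) \<le> 1"
    if "z \<in> carrier A" "nrm A (complex_of_real e \<odot> p \<oplus> z) \<le> e" for z
  proof -
    have "p \<oplus> complex_of_real (1 / e) \<odot> z = complex_of_real (1 / e) \<odot> (complex_of_real e \<odot> p \<oplus> z)"
      using e p that by (simp add: smult_add)
    also have "nrm A \<dots> = (1 / e) * nrm A (complex_of_real e \<odot> p \<oplus> z)"
      using e p that by (subst nrm_smult) (auto simp: norm_divide)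
    also have "\<dots> \<le> 1"
      using e that by simp
    finally show ?thesis .
  qed
  have "y = \<zero>"
  proof (rule corner_extreme_point[OF p])
    show "corner_selfadjoint p y"
      unfolding y_def using p x by (intro corner_selfadjoint_smult corner_positive_selfadjoint)
    show "nrm A (p \<oplus> y) \<le> 1"
      unfolding y_def using p d e by (intro scale corner_positive_larger_constant[OF p _ d(2)]) auto
    have "(-1) \<odot> y = complex_of_real (1 / e) \<odot> ((-1) \<odot> x)"
      by (simp add: y_def del: smult_minus_one)
    moreover have "nrm A (p \<oplus> complex_of_real (1 / e) \<odot> ((-1) \<odot> x)) \<le> 1"
      using p c e by (intro scale corner_positive_larger_constant[OF p _ c(2)]) auto
    ultimately show "nrm A (p \<oplus> (-1) \<odot> y) \<le> 1" by simp
  qed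
  then show ?thesis
    using e by (intro smult_cancel[of x "complex_of_real (1 / e)"]) (auto simp: y_def)
qed

lemma corner_positive_sum_zero:
  assumes p: "projection p" and "finite S" and pos: "\<And>i. i \<in> S \<Longrightarrow> corner_positive p (f i)"
    and zero: "finsum A f S = \<zero>" and i: "i \<in> S"
  shows "f i = \<zero>"
proof (rule corner_positive_antisym[OF p pos[OF i]])
  have fi: "f j \<in> carrier A" if "j \<in> S" for j
    using pos that by (auto dest: corner_positive_closed)
  let ?r = "finsum A f (S - {i})"
  have r: "?r \<in> carrier A"
    using fi by (auto intro!: finsum_closed)
  have "finsum A f (insert i (S - {i})) = f i \<oplus> ?r"
    using fi i \<open>finite S\<close> by (intro finsum_insert) auto
  then have "?r \<oplus> f i = \<zero>"
    using zero i fi[OF i] r by (simp add: insert_absorb a_comm)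
  then have "(-1) \<odot> f i = ?r"
    using fi[OF i] r minus_equality by auto
  then show "corner_positive p ((-1) \<odot> f i)"
    using pos p by (auto intro!: corner_positive_finsum)
qed

lemma projection_one: "projection \<one>"
  by (simp add: projection_def)

text \<open>
  The element \<open>1 - 2q\<close> is a self-adjoint unitary, hence of norm at most 1, and
  \<open>p/2 - pqp = p(1 - 2q)p/2\<close>. All positive elements below
  are built from this one by sums and nonnegative multiples.
\<close>

lemma corner_positive_compression:
  assumes p: "projection p" and q: "projection q"
  shows "corner_positive p (p \<otimes> q \<otimes> p)"
proof -
  note [simp] = p q
  let ?s = "\<one> \<oplus> (-2) \<odot> q"
  have "q \<oplus> (-2) \<odot> q = (-1) \<odot> q" "(-2) \<odot> q \<oplus> 2 \<odot> q = \<zero>"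
    using smult_scalar_add[of q 1 "-2"] smult_scalar_add[of q "-2" 2] by simp_all
  then have "star A ?s \<otimes> ?s = \<one>"
    by (simp add: star_add star_smult l_distr r_distr a_assoc del: smult_minus_one)
  then have "(nrm A ?s)\<^sup>2 \<le> 1"
    using nrm_star_mult[of ?s] nrm_projection_le_1[OF projection_one] by simp
  then have s: "nrm A ?s \<le> 1"
    using abs_square_le_1 nrm_ge_0[of ?s] by fastforce
  have "complex_of_real (1/2) \<odot> p \<oplus> (-1) \<odot> (p \<otimes> q \<otimes> p) = complex_of_real (1/2) \<odot> (p \<otimes> (?s \<otimes> p))"
    by (simp add: l_distr r_distr smult_add m_assoc del: smult_minus_one)
  also have "nrm A \<dots> \<le> 1/2 * (nrm A p * (nrm A ?s * nrm A p))"
    using nrm_mult[of p "?s \<otimes> p"] nrm_mult[of ?s p] nrm_ge_0[of p]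
    by (subst nrm_smult) (auto intro: order_trans mult_left_mono)
  also have "\<dots> \<le> 1/2 * (1 * (1 * 1))"
    using s nrm_projection_le_1[OF p] nrm_ge_0[of p] nrm_ge_0[of ?s]
    by (intro mult_mono) auto
  finally have le: "nrm A (complex_of_real (1/2) \<odot> p \<oplus> (-1) \<odot> (p \<otimes> q \<otimes> p)) \<le> 1/2"
    by simp
  have "p \<otimes> (p \<otimes> (q \<otimes> p)) = p \<otimes> (q \<otimes> p)"
    by (simp flip: m_assoc)
  then have "corner_selfadjoint p (p \<otimes> q \<otimes> p)"
    by (simp add: corner_selfadjoint_def star_mult m_assoc)
  then show ?thesis
    unfolding corner_positive_def using le by (intro conjI exI[of _ "1/2"]) auto
qed

lemma corner_positive_projection:
  assumes "projection p"
  shows "corner_positive p p"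
  using corner_positive_compression[OF assms assms] assms by simp

lemma corner_positive_one_projection:
  assumes "projection p"
  shows "corner_positive \<one> p"
  using corner_positive_compression[OF projection_one assms] assms by simp

text \<open>
  The C*-identity for \<open>qp\<close>, since \<open>(qp)\<^sup>*(qp) = pqp\<close>.
\<close>

lemma compression_zero_imp:
  assumes p: "projection p" and q: "projection q" and zero: "p \<otimes> q \<otimes> p = \<zero>"
  shows "p \<otimes> q = \<zero>" "q \<otimes> p = \<zero>"
proof -
  note [simp] = p q
  have "star A (q \<otimes> p) \<otimes> (q \<otimes> p) = p \<otimes> (q \<otimes> q) \<otimes> p"
    by (simp add: star_mult m_assoc del: projectionD(3))
  then have "(nrm A (q \<otimes> p))\<^sup>2 = 0"
    using zero nrm_star_mult[of "q \<otimes> p"] nrm_smult[of \<zero> 0] by simp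
  then show *: "q \<otimes> p = \<zero>"
    by (intro nrm_zero_imp) auto
  then have "star A (q \<otimes> p) = \<zero>" by simp
  then show "p \<otimes> q = \<zero>" by (simp add: star_mult)
qed

text \<open>
  Compressing \<open>\<Sum>\<^sub>k q\<^sub>k = 1\<close> to the corner of \<open>q\<^sub>i\<close> leaves a vanishing sum of the positive
  elements \<open>q\<^sub>i q\<^sub>k q\<^sub>i\<close> with \<open>k \<noteq> i\<close>.
\<close>

lemma projections_sum_one_orthogonal:
  assumes fin: "finite S" and q: "\<And>i. i \<in> S \<Longrightarrow> projection (q i)" and sum: "finsum A q S = \<one>"
    and ij: "i \<in> S" "j \<in> S" "i \<noteq> j"
  shows "q i \<otimes> q j = \<zero>"
proof -
  let ?p = "q i"
  have p: "projection ?p" and qc: "q k \<in> carrier A" if "k \<in> S" for k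
    using q ij that by auto
  note [simp] = p qc[OF ij(1)]
  let ?r = "finsum A q (S - {i})"
  have r: "?r \<in> carrier A"
    using qc by (auto intro!: finsum_closed)
  have "finsum A q (insert i (S - {i})) = ?p \<oplus> ?r"
    using fin qc by (intro finsum_insert) auto
  then have one: "\<one> = ?p \<oplus> ?r"
    using sum ij by (simp add: insert_absorb)
  have "?p = ?p \<otimes> (?p \<oplus> ?r) \<otimes> ?p"
    unfolding one[symmetric] using ij by simp
  also have "\<dots> = ?p \<oplus> ?p \<otimes> ?r \<otimes> ?p"
    using r ij by (simp add: r_distr l_distr)
  finally have "?p \<otimes> ?r \<otimes> ?p = \<zero>"
    using r ij by (metis add.l_cancel_one m_closed qc)
  moreover have "?p \<otimes> ?r \<otimes> ?p = finsum A (\<lambda>k. ?p \<otimes> q k \<otimes> ?p) (S - {i})"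
    using fin qc ij
      finsum_rdistr[of "S - {i}" ?p q] finsum_ldistr[of "S - {i}" ?p "\<lambda>k. ?p \<otimes> q k"]
    by (simp add: Pi_iff)
  ultimately have "?p \<otimes> q j \<otimes> ?p = \<zero>"
    using corner_positive_sum_zero[of ?p "S - {i}" "\<lambda>k. ?p \<otimes> q k \<otimes> ?p" j] fin ij q
    by (auto intro!: corner_positive_compression)
  then show ?thesis
    using compression_zero_imp q ij by blast
qed

end

section \<open>Magic unitaries and distances\<close>

context pre_cstar_algebra
begin

lemma finsum_mult_left:
  assumes "finite S" "a \<in> carrier A" "\<And>i. i \<in> S \<Longrightarrow> f i \<in> carrier A"
  shows "a \<otimes> finsum A f S = finsum A (\<lambda>i. a \<otimes> f i) S"
  using assms by (intro finsum_rdistr) auto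

lemma finsum_mult_right:
  assumes "finite S" "a \<in> carrier A" "\<And>i. i \<in> S \<Longrightarrow> f i \<in> carrier A"
  shows "finsum A f S \<otimes> a = finsum A (\<lambda>i. f i \<otimes> a) S"
  using assms by (intro finsum_ldistr) auto

lemma smult_eq_imp_zero:
  assumes "a \<in> carrier A" "c \<odot> a = d \<odot> a" "c \<noteq> d"
  shows "a = \<zero>"
proof -
  have "(c - d) \<odot> a = \<zero>"
    using assms smult_scalar_add[of a c "-d"] smult_scalar_add[of a d "-d"] by simp
  then show ?thesis
    using assms smult_cancel by auto
qed

lemma magic_unitaryD:
  assumes "magic_unitary A u"
  shows "projection (u x y)" "u x y \<in> carrier A"
    "finsum A (\<lambda>z. u x z) UNIV = \<one>" "finsum A (\<lambda>z. u z y) UNIV = \<one>"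
  using assms unfolding magic_unitary_def projection_def by blast+

lemma magic_unitary_orthogonal:
  fixes u :: "'x::finite \<Rightarrow> 'x \<Rightarrow> 'a"
  assumes "magic_unitary A u"
  shows "y \<noteq> z \<Longrightarrow> u x y \<otimes> u x z = \<zero>" "y \<noteq> z \<Longrightarrow> u y x \<otimes> u z x = \<zero>"
  using projections_sum_one_orthogonal[of UNIV "\<lambda>y. u x y" y z]
    projections_sum_one_orthogonal[of UNIV "\<lambda>y. u y x" y z] magic_unitaryD[OF assms]
  by auto

text \<open>
  The weight splits into a part depending on the column and a part depending on the row, and either
  part can be summed after a column or row sum has been taken. This is used twice: for a magic
  unitary, and for the compression of a magic unitary to the corner of one of its entries.
\<close>

lemma doubly_stochastic_weighted_sum:
  fixes f :: "'x::finite \<Rightarrow> 'x \<Rightarrow> 'a"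
  assumes f: "\<And>i k. f i k \<in> carrier A" and a: "a \<in> carrier A"
    and rows: "\<And>i. finsum A (\<lambda>k. f i k) UNIV = a" and cols: "\<And>k. finsum A (\<lambda>i. f i k) UNIV = a"
  shows "finsum A (\<lambda>i. finsum A (\<lambda>k. (c k - e i) \<odot> f i k) UNIV) UNIV = (sum c UNIV - sum e UNIV) \<odot> a"
proof -
  have "finsum A (\<lambda>k. (c k - e i) \<odot> f i k) UNIV = finsum A (\<lambda>k. c k \<odot> f i k) UNIV \<oplus> (- e i) \<odot> a" for i
    using f smult_scalar_add[of _ _ "- e i"]
    by (simp add: finsum_addf rows smult_finsum[symmetric])
  then have "finsum A (\<lambda>i. finsum A (\<lambda>k. (c k - e i) \<odot> f i k) UNIV) UNIV =
      finsum A (\<lambda>i. finsum A (\<lambda>k. c k \<odot> f i k) UNIV) UNIV \<oplus> finsum A (\<lambda>i. (- e i) \<odot> a) UNIV"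
    using f a by (simp add: finsum_addf finsum_closed)
  also have "finsum A (\<lambda>i. finsum A (\<lambda>k. c k \<odot> f i k) UNIV) UNIV = finsum A (\<lambda>k. c k \<odot> a) UNIV"
    using f by (subst finsum_swap) (simp_all add: cols smult_finsum[symmetric])
  finally show ?thesis
    using a by (simp add: finsum_scalar sum_negf flip: smult_scalar_add)
qed

text \<open>
  The one-sided condition says that a magic unitary never moves a pair of points to a pair at larger
  distance; there is no room for decreasing distances either, since the total distance is the same
  before and after. To make this precise, put \<open>R\<^sub>m = \<Sum>\<^sub>n d(m, n)\<close>. In the corner of \<open>u\<^sub>i\<^sub>k\<close>,
  \<open>\<Sum>\<^sub>j\<^sub>l (d(k, l) - d(i, j)) u\<^sub>i\<^sub>k u\<^sub>j\<^sub>l u\<^sub>i\<^sub>k = (R\<^sub>k - R\<^sub>i) u\<^sub>i\<^sub>k\<close>,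
  and all terms on the left are positive. So \<open>R\<^sub>k \<ge> R\<^sub>i\<close> unless \<open>u\<^sub>i\<^sub>k = 0\<close>, and the elements
  \<open>(R\<^sub>k - R\<^sub>i) u\<^sub>i\<^sub>k\<close> are positive with sum \<open>\<Sum>\<^sub>k R\<^sub>k - \<Sum>\<^sub>i R\<^sub>i = 0\<close>. They vanish, so the terms on the
  left vanish too, and \<open>u\<^sub>i\<^sub>k u\<^sub>j\<^sub>l u\<^sub>i\<^sub>k = 0\<close> means \<open>u\<^sub>i\<^sub>k u\<^sub>j\<^sub>l = 0\<close>.
\<close>

lemma intertwines_distances_of_strict:
  fixes d :: "'x::finite \<Rightarrow> 'x \<Rightarrow> real"
  assumes u: "magic_unitary A u"
    and strict: "\<And>i j k l. d k l < d i j \<Longrightarrow> u i k \<otimes> u j l = \<zero>"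
    and neq: "d k l \<noteq> d i j"
  shows "u i k \<otimes> u j l = \<zero>"
proof -
  note proj = magic_unitaryD(1)[OF u]
  note [simp] = magic_unitaryD(2)[OF u] and [simp del] = of_real_diff
  define R where "R m = (\<Sum>n\<in>UNIV. d m n)" for m
  define t where "t i k j l = u i k \<otimes> u j l \<otimes> u i k" for i k j l
  have t [simp]: "t i k j l \<in> carrier A" for i k j l
    by (simp add: t_def)
  have t_pos: "corner_positive (u i k) (complex_of_real (d k l - d i j) \<odot> t i k j l)" for i k j l
  proof (cases "d k l < d i j")
    case True
    then show ?thesis
      using strict[OF True] proj by (simp add: t_def corner_positive_zero)
  next
    case False
    then show ?thesis
      unfolding t_def using proj by (intro corner_positive_smult corner_positive_compression) auto
  qed
  have t_sum: "finsum A (\<lambda>j. finsum A (\<lambda>l. complex_of_real (d k l - d i j) \<odot> t i k j l) UNIV) UNIV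
      = complex_of_real (R k - R i) \<odot> u i k" for i k
  proof -
    have "finsum A (\<lambda>l. t i k j l) UNIV = u i k" "finsum A (\<lambda>j. t i k j l) UNIV = u i k" for j l
      using magic_unitaryD(3,4)[OF u] proj
      by (simp_all add: t_def flip: finsum_mult_left finsum_mult_right)
    then show ?thesis
      using doubly_stochastic_weighted_sum[of "t i k" "u i k" "\<lambda>l. complex_of_real (d k l)" "\<lambda>j. complex_of_real (d i j)"]
      by (simp add: R_def of_real_diff)
  qed
  have row_pos: "corner_positive (u i k)
      (finsum A (\<lambda>l. complex_of_real (d k l - d i j) \<odot> t i k j l) UNIV)" for i k j
    using proj t_pos by (intro corner_positive_finsum) auto
  have R_pos: "corner_positive (u i k) (complex_of_real (R k - R i) \<odot> u i k)" for i k
    unfolding t_sum[symmetric] by (rule corner_positive_finsum[OF proj row_pos])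
  have u_pos: "corner_positive \<one> (complex_of_real (R k - R i) \<odot> u i k)" for i k
  proof (cases "R i \<le> R k")
    case True
    then show ?thesis
      using proj by (intro corner_positive_smult corner_positive_one_projection projection_one) auto
  next
    case False
    then have "corner_positive (u i k) (complex_of_real (R i - R k) \<odot> u i k)"
      using proj by (intro corner_positive_smult corner_positive_projection) auto
    also have "complex_of_real (R i - R k) \<odot> u i k = (-1) \<odot> (complex_of_real (R k - R i) \<odot> u i k)"
      by (simp add: of_real_diff del: smult_minus_one)
    finally show ?thesis
      using corner_positive_antisym[OF proj R_pos] corner_positive_zero[OF projection_one] by simp
  qed
  have "finsum A (\<lambda>i. finsum A (\<lambda>k. complex_of_real (R k - R i) \<odot> u i k) UNIV) UNIV = \<zero>"
    using doubly_stochastic_weighted_sum[of u \<one> "\<lambda>k. complex_of_real (R k)" "\<lambda>i. complex_of_real (R i)"]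
      magic_unitaryD(3,4)[OF u] by (simp add: of_real_diff)
  moreover have "corner_positive \<one> (finsum A (\<lambda>k. complex_of_real (R k - R i) \<odot> u i k) UNIV)" for i
    by (rule corner_positive_finsum[OF projection_one u_pos])
  ultimately have "finsum A (\<lambda>k. complex_of_real (R k - R i) \<odot> u i k) UNIV = \<zero>"
    by (intro corner_positive_sum_zero[OF projection_one finite,
        where S = UNIV and f = "\<lambda>i. finsum A (\<lambda>k. complex_of_real (R k - R i) \<odot> u i k) UNIV"]) auto
  then have "complex_of_real (R k - R i) \<odot> u i k = \<zero>"
    using u_pos
    by (intro corner_positive_sum_zero[OF projection_one finite,
        where S = UNIV and f = "\<lambda>k. complex_of_real (R k - R i) \<odot> u i k"]) auto
  then have "finsum A (\<lambda>l. complex_of_real (d k l - d i j) \<odot> t i k j l) UNIV = \<zero>"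
    using row_pos
    by (intro corner_positive_sum_zero[OF proj finite,
        where S = UNIV and f = "\<lambda>j. finsum A (\<lambda>l. complex_of_real (d k l - d i j) \<odot> t i k j l) UNIV"])
      (auto simp: t_sum)
  then have "complex_of_real (d k l - d i j) \<odot> t i k j l = \<zero>"
    using t_pos
    by (intro corner_positive_sum_zero[OF proj finite,
        where S = UNIV and f = "\<lambda>l. complex_of_real (d k l - d i j) \<odot> t i k j l"]) auto
  from smult_cancel[OF t this] have "t i k j l = \<zero>"
    using neq by simp
  then show ?thesis
    unfolding t_def by (rule compression_zero_imp(1)[OF proj proj])
qed

text \<open>
  For the forward direction, the \<open>(i, l)\<close> entry of \<open>UD = DU\<close> is multiplied by \<open>u\<^sub>i\<^sub>k\<close> from the left and
  by \<open>u\<^sub>j\<^sub>l\<close> from the right, which isolates \<open>d(k, l) u\<^sub>i\<^sub>k u\<^sub>j\<^sub>l = d(i, j) u\<^sub>i\<^sub>k u\<^sub>j\<^sub>l\<close>. For the converse, a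
  column sum is inserted on the right of \<open>UD\<close> and a row sum on the left of \<open>DU\<close>.
\<close>

lemma commutes_with_distances_iff:
  fixes d :: "'x::finite \<Rightarrow> 'x \<Rightarrow> real"
  assumes u: "magic_unitary A u"
  shows "commutes_with_distances d A u \<longleftrightarrow> (\<forall>i j k l. d k l \<noteq> d i j \<longrightarrow> u i k \<otimes> u j l = \<zero>)"
proof
  note [simp] = magic_unitaryD(1,2)[OF u] magic_unitary_orthogonal[OF u]
  assume comm: "commutes_with_distances d A u"
  show "\<forall>i j k l. d k l \<noteq> d i j \<longrightarrow> u i k \<otimes> u j l = \<zero>"
  proof (intro allI impI)
    fix i j k l
    assume neq: "d k l \<noteq> d i j"
    let ?L = "finsum A (\<lambda>z. complex_of_real (d z l) \<odot> u i z) UNIV"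
    let ?R = "finsum A (\<lambda>z. complex_of_real (d i z) \<odot> u z l) UNIV"
    have LR: "?L = ?R" "?L \<in> carrier A" "?R \<in> carrier A"
      using comm by (auto simp: commutes_with_distances_def intro!: finsum_closed)
    have "u i k \<otimes> ?L = finsum A (\<lambda>z. u i k \<otimes> (complex_of_real (d z l) \<odot> u i z)) UNIV"
      by (intro finsum_mult_left) auto
    also have "\<dots> = complex_of_real (d k l) \<odot> u i k"
      by (subst finsum_only[of _ k]) auto
    finally have L: "u i k \<otimes> ?L = complex_of_real (d k l) \<odot> u i k" .
    have "?R \<otimes> u j l = finsum A (\<lambda>z. (complex_of_real (d i z) \<odot> u z l) \<otimes> u j l) UNIV"
      by (intro finsum_mult_right) auto
    also have "\<dots> = complex_of_real (d i j) \<odot> u j l"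
      by (subst finsum_only[of _ j]) auto
    finally have R: "?R \<otimes> u j l = complex_of_real (d i j) \<odot> u j l" .
    have "(u i k \<otimes> ?L) \<otimes> u j l = u i k \<otimes> (?R \<otimes> u j l)"
      using LR by (simp add: m_assoc)
    then show "u i k \<otimes> u j l = \<zero>"
      unfolding L R using neq
        smult_eq_imp_zero[of "u i k \<otimes> u j l" "complex_of_real (d k l)" "complex_of_real (d i j)"]
      by simp
  qed
next
  note [simp] = magic_unitaryD(1,2)[OF u]
  assume zero: "\<forall>i j k l. d k l \<noteq> d i j \<longrightarrow> u i k \<otimes> u j l = \<zero>"
  show "commutes_with_distances d A u"
    unfolding commutes_with_distances_def
  proof (intro allI)
    fix x y
    have "finsum A (\<lambda>z. complex_of_real (d z y) \<odot> u x z) UNIV =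
        finsum A (\<lambda>z. finsum A (\<lambda>w. complex_of_real (d z y) \<odot> (u x z \<otimes> u w y)) UNIV) UNIV"
      using magic_unitaryD(4)[OF u, of y]
      by (intro finsum_cong') (auto simp flip: smult_finsum finsum_mult_left)
    also have "\<dots> = finsum A (\<lambda>z. finsum A (\<lambda>w. complex_of_real (d x w) \<odot> (u x z \<otimes> u w y)) UNIV) UNIV"
    proof (intro finsum_cong')
      show "complex_of_real (d z y) \<odot> (u x z \<otimes> u w y) = complex_of_real (d x w) \<odot> (u x z \<otimes> u w y)" for z w
        using zero by (cases "d z y = d x w") auto
    qed (auto intro!: finsum_closed)
    also have "\<dots> = finsum A (\<lambda>w. finsum A (\<lambda>z. complex_of_real (d x w) \<odot> (u x z \<otimes> u w y)) UNIV) UNIV"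
      by (intro finsum_swap) auto
    also have "\<dots> = finsum A (\<lambda>w. complex_of_real (d x w) \<odot> u w y) UNIV"
      using magic_unitaryD(3)[OF u, of x]
      by (intro finsum_cong') (auto simp flip: smult_finsum finsum_mult_right)
    finally show "finsum A (\<lambda>z. complex_of_real (d z y) \<odot> u x z) UNIV =
        finsum A (\<lambda>z. complex_of_real (d x z) \<odot> u z y) UNIV" .
  qed
qed

end

section \<open>Quantum isometry relations on the bounded functions\<close>

text \<open>
  The vectors of the orthonormal basis are the indicator functions multiplied by this scalar, which
  therefore appears in the structure constants of the algebra with respect to this basis.
\<close>

abbreviation basis_scale :: "'x::finite itself \<Rightarrow> complex" where
  "basis_scale _ \<equiv> complex_of_real (sqrt (real CARD('x)))"

lemma basis_scale_square:
  "basis_scale TYPE('x::finite) * basis_scale TYPE('x) = of_nat CARD('x)"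
  by (simp flip: of_real_mult)

context pre_cstar_algebra
begin

lemma fd_tensor_linf_mult:
  fixes a b :: "'x::finite \<Rightarrow> 'a"
  assumes "\<And>x. a x \<in> carrier A" "\<And>x. b x \<in> carrier A"
  shows "a \<otimes>\<^bsub>fd_tensor linf uniform_trace point_basis A\<^esub> b =
    (\<lambda>x. basis_scale TYPE('x) \<odot> (a x \<otimes> b x))"
proof
  fix x
  let ?r = "basis_scale TYPE('x)"
  have coord: "coord linf uniform_trace point_basis (point_basis k \<otimes>\<^bsub>linf\<^esub> point_basis l) i =
      (if k = i \<and> l = i then ?r else 0)" for k l i :: 'x
    by (auto simp: coord_linf linf_simps point_basis_def divide_eq_eq basis_scale_square)
  have "(a \<otimes>\<^bsub>fd_tensor linf uniform_trace point_basis A\<^esub> b) x =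
      finsum A (\<lambda>(k, l). (if k = x \<and> l = x then ?r else 0) \<odot> (a k \<otimes> b l)) UNIV"
    by (simp add: fd_tensor_def coord)
  also have "\<dots> = ?r \<odot> (a x \<otimes> b x)"
    using assms by (subst finsum_only[of _ "(x, x)"]) (auto split: if_splits)
  finally show "(a \<otimes>\<^bsub>fd_tensor linf uniform_trace point_basis A\<^esub> b) x = ?r \<odot> (a x \<otimes> b x)" .
qed

lemma fd_tensor_linf_star:
  fixes a :: "'x::finite \<Rightarrow> 'a"
  assumes "\<And>x. a x \<in> carrier A"
  shows "star (fd_tensor linf uniform_trace point_basis A) a = (\<lambda>x. star A (a x))"
proof
  fix x
  have coord: "coord linf uniform_trace point_basis (star linf (point_basis k)) i =
      (if k = i then 1 else 0)" for k i :: 'x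
    by (auto simp: coord_linf linf_simps point_basis_def)
  have "star (fd_tensor linf uniform_trace point_basis A) a x =
      finsum A (\<lambda>k. (if k = x then 1 else 0) \<odot> star A (a k)) UNIV"
    by (simp add: fd_tensor_def coord)
  also have "\<dots> = star A (a x)"
    using assms by (subst finsum_only[of _ x]) auto
  finally show "star (fd_tensor linf uniform_trace point_basis A) a x = star A (a x)" .
qed

lemma fd_tensor_linf_one:
  "one (fd_tensor linf uniform_trace (point_basis :: 'x::finite \<Rightarrow> _) A) =
     (\<lambda>_. (1 / basis_scale TYPE('x)) \<odot> \<one>)"
  by (simp add: fd_tensor_def coord_linf) (simp add: linf_def)

lemma coaction_linf:
  "coaction linf uniform_trace (point_basis :: 'x::finite \<Rightarrow> _) A u f =
     (\<lambda>k. finsum A (\<lambda>j. (f j / basis_scale TYPE('x)) \<odot> u k j) UNIV)"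
  by (simp add: coaction_def coord_linf)

lemma coaction_point_basis:
  fixes u :: "'x::finite \<Rightarrow> 'x \<Rightarrow> 'a"
  assumes "\<And>x y. u x y \<in> carrier A"
  shows "coaction linf uniform_trace point_basis A u (\<lambda>x. c * point_basis y x) = (\<lambda>k. c \<odot> u k y)"
  unfolding coaction_linf
  by (rule ext, subst finsum_only[of _ y]) (auto simp: assms point_basis_def)

lemma orthogonal_projections_mult:
  fixes q :: "'x::finite \<Rightarrow> 'a"
  assumes q: "\<And>i. projection (q i)" and orth: "\<And>i j. i \<noteq> j \<Longrightarrow> q i \<otimes> q j = \<zero>"
  shows "finsum A (\<lambda>i. a i \<odot> q i) UNIV \<otimes> finsum A (\<lambda>i. b i \<odot> q i) UNIV =
    finsum A (\<lambda>i. (a i * b i) \<odot> q i) UNIV"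
proof -
  note [simp] = q
  have "a i \<odot> q i \<otimes> finsum A (\<lambda>i. b i \<odot> q i) UNIV = (a i * b i) \<odot> q i" for i
  proof -
    have "(a i \<odot> q i) \<otimes> finsum A (\<lambda>i. b i \<odot> q i) UNIV =
        finsum A (\<lambda>j. (a i \<odot> q i) \<otimes> (b j \<odot> q j)) UNIV"
      by (intro finsum_mult_left) auto
    also have "\<dots> = (a i * b i) \<odot> q i"
      using orth by (subst finsum_only[of _ i]) (auto simp: mult.commute)
    finally show ?thesis .
  qed
  then show ?thesis
    by (subst finsum_mult_right) (auto intro!: finsum_closed)
qed

lemma coaction_unital_star_hom:
  fixes u :: "'x::finite \<Rightarrow> 'x \<Rightarrow> 'a"
  assumes u: "magic_unitary A u"
  shows "unital_star_hom linf (fd_tensor linf uniform_trace point_basis A)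
    (coaction linf uniform_trace point_basis A u)"
proof -
  let ?r = "basis_scale TYPE('x)"
  let ?\<delta> = "coaction linf uniform_trace point_basis A u"
  let ?B = "fd_tensor linf uniform_trace (point_basis :: 'x \<Rightarrow> _) A"
  note [simp] = magic_unitaryD(1,2)[OF u]
  have \<delta>: "?\<delta> f k \<in> carrier A" for f k
    by (auto simp: coaction_linf intro!: finsum_closed)
  have add: "?\<delta> (f \<oplus>\<^bsub>linf\<^esub> g) = ?\<delta> f \<oplus>\<^bsub>?B\<^esub> ?\<delta> g" for f g
    by (simp add: fd_tensor_def) 
      (simp add: coaction_linf linf_simps add_divide_distrib smult_scalar_add finsum_addf)
  have smult: "?\<delta> (c \<odot>\<^bsub>linf\<^esub> f) = c \<odot>\<^bsub>?B\<^esub> ?\<delta> f" for c f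
    by (simp add: fd_tensor_def) (simp add: coaction_linf linf_simps smult_finsum)
  have star: "?\<delta> (star linf f) = star ?B (?\<delta> f)" for f
    by (simp add: fd_tensor_linf_mult fd_tensor_linf_star \<delta>) (simp add: coaction_linf linf_simps star_finsum star_smult)
  have one: "?\<delta> \<one>\<^bsub>linf\<^esub> = \<one>\<^bsub>?B\<^esub>"
    using magic_unitaryD(3)[OF u]
    by (simp add: fd_tensor_linf_one coaction_linf) (simp add: linf_def flip: smult_finsum)
  have mult: "?\<delta> (f \<otimes>\<^bsub>linf\<^esub> g) = ?\<delta> f \<otimes>\<^bsub>?B\<^esub> ?\<delta> g" for f g
  proof
    fix k
    have "(?\<delta> f \<otimes>\<^bsub>?B\<^esub> ?\<delta> g) k = ?r \<odot> (?\<delta> f k \<otimes> ?\<delta> g k)"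
      by (simp add: fd_tensor_linf_mult fd_tensor_linf_star \<delta>)
    also have "?\<delta> f k \<otimes> ?\<delta> g k = finsum A (\<lambda>j. (f j / ?r * (g j / ?r)) \<odot> u k j) UNIV"
      unfolding coaction_linf
      using magic_unitary_orthogonal[OF u] by (intro orthogonal_projections_mult) auto
    also have "?r \<odot> \<dots> = finsum A (\<lambda>j. (f j * g j / ?r) \<odot> u k j) UNIV"
      by (simp add: smult_finsum)
    finally show "?\<delta> (f \<otimes>\<^bsub>linf\<^esub> g) k = (?\<delta> f \<otimes>\<^bsub>?B\<^esub> ?\<delta> g) k"
      by (simp add: coaction_linf linf_simps)
  qed
  have "?\<delta> f \<in> carrier ?B" for f
    using \<delta> by (auto simp: fd_tensor_def)
  with add smult star one mult show ?thesis
    by (auto simp: unital_star_hom_def intro!: ring_hom_memI)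
qed

text \<open>
  On the basis vector at the point \<open>y\<close> the coaction is the column \<open>y\<close> of \<open>u\<close>. Compatibility with the
  involution and with squares of basis vectors makes the entries projections, unitality gives
  the row sums, and invariance of the trace gives the column sums. Conversely, multiplicativity and
  unitarity of \<open>u\<close> need orthogonality within rows and columns, which magic unitaries over a
  pre-C*-algebra have.
\<close>

lemma magic_unitary_iff_coaction:
  fixes u :: "'x::finite \<Rightarrow> 'x \<Rightarrow> 'a"
  defines "\<delta> \<equiv> coaction linf uniform_trace point_basis A u"
  shows "magic_unitary A u \<longleftrightarrow>
    unitary_matrix A u \<and> unital_star_hom linf (fd_tensor linf uniform_trace point_basis A) \<delta> \<and>
    trace_preserving linf uniform_trace point_basis A \<delta>"
proof (intro iffI conjI)
  assume u: "magic_unitary A u"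
  note [simp] = magic_unitaryD(1,2)[OF u]
  show "unitary_matrix A u"
    using magic_unitary_orthogonal[OF u] magic_unitaryD[OF u]
    by (auto simp: unitary_matrix_def if_distrib cong: if_cong)
  show "unital_star_hom linf (fd_tensor linf uniform_trace point_basis A) \<delta>"
    unfolding \<delta>_def by (rule coaction_unital_star_hom[OF u])
  have "finsum A (\<lambda>k. uniform_trace (point_basis k :: 'x \<Rightarrow> complex) \<odot> \<delta> f k) UNIV = uniform_trace f \<odot> \<one>" for f
  proof -
    have "finsum A (\<lambda>k. uniform_trace (point_basis k :: 'x \<Rightarrow> complex) \<odot> \<delta> f k) UNIV =
        finsum A (\<lambda>k. finsum A (\<lambda>j. (f j / of_nat CARD('x)) \<odot> u k j) UNIV) UNIV"
    proof (intro finsum_cong')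
      fix k
      have "uniform_trace (point_basis k :: 'x \<Rightarrow> complex) = basis_scale TYPE('x) / of_nat CARD('x)"
        by (simp add: uniform_trace_def point_basis_def)
      then show "uniform_trace (point_basis k :: 'x \<Rightarrow> complex) \<odot> \<delta> f k = finsum A (\<lambda>j. (f j / of_nat CARD('x)) \<odot> u k j) UNIV"
        by (simp add: \<delta>_def coaction_linf smult_finsum)
    qed (auto intro!: finsum_closed)
    also have "\<dots> = finsum A (\<lambda>j. finsum A (\<lambda>k. (f j / of_nat CARD('x)) \<odot> u k j) UNIV) UNIV"
      by (intro finsum_swap) auto
    also have "\<dots> = finsum A (\<lambda>j. (f j / of_nat CARD('x)) \<odot> \<one>) UNIV"
      using magic_unitaryD(4)[OF u] by (simp flip: smult_finsum)
    also have "\<dots> = uniform_trace f \<odot> \<one>"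
      by (simp add: finsum_scalar uniform_trace_def sum_divide_distrib)
    finally show ?thesis .
  qed
  then show "trace_preserving linf uniform_trace point_basis A \<delta>"
    by (simp add: trace_preserving_def)
next
  let ?r = "basis_scale TYPE('x)"
  let ?B = "fd_tensor linf uniform_trace (point_basis :: 'x \<Rightarrow> _) A"
  assume *: "unitary_matrix A u \<and> unital_star_hom linf ?B \<delta> \<and>
    trace_preserving linf uniform_trace point_basis A \<delta>"
  then have [simp]: "u x y \<in> carrier A" for x y
    by (auto simp: unitary_matrix_def)
  note cb = coaction_point_basis[of u, folded \<delta>_def, simplified]
  have hom: "\<delta> \<in> ring_hom linf ?B" and star: "\<delta> (star linf f) = star ?B (\<delta> f)"
    and trace: "finsum A (\<lambda>k. uniform_trace (point_basis k) \<odot> \<delta> f k) UNIV = uniform_trace f \<odot> \<one>" for f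
    using * by (auto simp: unital_star_hom_def trace_preserving_def linf_simps)
  have \<delta>_basis: "\<delta> (point_basis y) = (\<lambda>k. u k y)" for y
    using cb[of 1 y] by simp
  have "u x y = star A (u x y)" for x y
  proof -
    have "star linf (point_basis y) = point_basis y"
      by (auto simp: linf_simps point_basis_def)
    then have "\<delta> (point_basis y) = star ?B (\<delta> (point_basis y))"
      using star[of "point_basis y"] by simp
    then show ?thesis
      by (simp add: fd_tensor_linf_mult fd_tensor_linf_star \<delta>_basis fun_eq_iff)
  qed
  moreover have "u x y \<otimes> u x y = u x y" for x y
  proof -
    have "point_basis y \<otimes>\<^bsub>linf\<^esub> point_basis y = (\<lambda>x. ?r * point_basis y x)"
      by (auto simp: linf_simps point_basis_def)
    then have "(\<lambda>k. ?r \<odot> u k y) = \<delta> (point_basis y) \<otimes>\<^bsub>?B\<^esub> \<delta> (point_basis y)"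
      using ring_hom_mult[OF hom, of "point_basis y" "point_basis y"] by (simp add: linf_simps cb)
    then have "?r \<odot> u x y = ?r \<odot> (u x y \<otimes> u x y)"
      by (simp add: fd_tensor_linf_mult fd_tensor_linf_star \<delta>_basis fun_eq_iff)
    then have "(1 / ?r) \<odot> (?r \<odot> u x y) = (1 / ?r) \<odot> (?r \<odot> (u x y \<otimes> u x y))"
      by (rule arg_cong)
    then show ?thesis by simp
  qed
  moreover have "finsum A (\<lambda>y. u x y) UNIV = \<one>" for x
  proof -
    have "\<delta> \<one>\<^bsub>linf\<^esub> x = (1 / ?r) \<odot> \<one>"
      using ring_hom_one[OF hom] by (simp add: fd_tensor_linf_one)
    moreover have "\<delta> \<one>\<^bsub>linf\<^esub> x = (1 / ?r) \<odot> finsum A (\<lambda>y. u x y) UNIV"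
      unfolding \<delta>_def coaction_linf by (simp add: linf_def smult_finsum)
    ultimately have "?r \<odot> ((1 / ?r) \<odot> finsum A (\<lambda>y. u x y) UNIV) = ?r \<odot> ((1 / ?r) \<odot> \<one>)"
      by simp
    then show ?thesis
      by (simp add: finsum_closed)
  qed
  moreover have "finsum A (\<lambda>x. u x y) UNIV = \<one>" for y
  proof -
    define t where "t = ?r / of_nat CARD('x)"
    have t: "uniform_trace (point_basis k :: 'x \<Rightarrow> complex) = t" "t \<noteq> 0" for k
      by (simp_all add: t_def uniform_trace_def point_basis_def)
    have "t \<odot> finsum A (\<lambda>x. u x y) UNIV = t \<odot> \<one>"
      using trace[of "point_basis y"] by (simp add: t(1) \<delta>_basis smult_finsum)
    then have "(1 / t) \<odot> (t \<odot> finsum A (\<lambda>x. u x y) UNIV) = (1 / t) \<odot> (t \<odot> \<one>)"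
      by (rule arg_cong)
    then show ?thesis
      using t(2) by (simp add: finsum_closed)
  qed
  ultimately show "magic_unitary A u"
    by (simp add: magic_unitary_def)
qed

text \<open>
  The space at \<open>t\<close> is spanned by matrix units, so membership in its tensor product is read off entry by
  entry. For the converse, the sum over matrix units is indexed by an enumeration \<open>h\<close> of all pairs of
  points, and pairs at distance greater than \<open>t\<close> contribute the zero matrix.
\<close>

lemma space_tensor_metric_filtration_iff:
  fixes d :: "'x::finite \<Rightarrow> 'x \<Rightarrow> real"
  assumes "\<And>x y. v x y \<in> carrier A"
  shows "v \<in> space_tensor (metric_filtration d t) A \<longleftrightarrow> (\<forall>x y. d x y > t \<longrightarrow> v x y = \<zero>)"
proof
  assume "v \<in> space_tensor (metric_filtration d t) A"
  then obtain N :: nat and S a where v: "v = (\<lambda>i j. finsum A (\<lambda>r. S r $ i $ j \<odot> a r) {..<N})"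
    and S: "\<And>r. r < N \<Longrightarrow> S r \<in> metric_filtration d t" and a: "\<And>r. r < N \<Longrightarrow> a r \<in> carrier A"
    unfolding space_tensor_def by blast
  show "\<forall>x y. d x y > t \<longrightarrow> v x y = \<zero>"
    unfolding v using S a
    by (auto simp: metric_filtration_def intro!: add.finprod_one_eqI)
next
  assume zero: "\<forall>x y. d x y > t \<longrightarrow> v x y = \<zero>"
  let ?N = "card (UNIV :: ('x \<times> 'x) set)"
  obtain h :: "nat \<Rightarrow> 'x \<times> 'x" where h: "bij_betw h {..<?N} UNIV"
    using ex_bij_betw_nat_finite[of "UNIV :: ('x \<times> 'x) set"] by (auto simp: atLeast0LessThan)
  define S :: "nat \<Rightarrow> complex^'x^'x" where
    "S r = (\<chi> i j. if h r = (i, j) \<and> d i j \<le> t then 1 else 0)" for r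
  define a where "a r = v (fst (h r)) (snd (h r))" for r
  have "v i j = finsum A (\<lambda>r. S r $ i $ j \<odot> a r) {..<?N}" for i j
  proof -
    obtain r where r: "r < ?N" "h r = (i, j)"
      using h by (auto simp: bij_betw_def) (metis UNIV_I imageE lessThan_iff)
    have uniq: "h r' \<noteq> (i, j)" if "r' < ?N" "r' \<noteq> r" for r'
      using h r that by (auto simp: bij_betw_def inj_on_def)
    have "finsum A (\<lambda>r. S r $ i $ j \<odot> a r) {..<?N} = S r $ i $ j \<odot> a r"
      using r assms uniq by (subst finsum_only[of _ r]) (auto simp: S_def a_def)
    then show ?thesis
      using r zero assms by (auto simp: S_def a_def)
  qed
  moreover have "S r \<in> metric_filtration d t" "a r \<in> carrier A" for r
    using assms by (auto simp: metric_filtration_def S_def a_def)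
  ultimately show "v \<in> space_tensor (metric_filtration d t) A"
    unfolding space_tensor_def by (auto simp: fun_eq_iff intro!: exI[of _ ?N] exI[of _ S] exI[of _ a])
qed

text \<open>
  The test operators are the matrix units: conjugating the one at \<open>(k, l)\<close>, which belongs to the space at
  \<open>t = d(k, l)\<close>, gives the matrix with entries \<open>u\<^sub>i\<^sub>k u\<^sub>j\<^sub>l\<close>.
\<close>

lemma conj_matrix_preserves_metric_filtration_iff:
  fixes d :: "'x::finite \<Rightarrow> 'x \<Rightarrow> real"
  assumes u: "magic_unitary A u" and d: "\<And>x y. 0 \<le> d x y"
  shows "(\<forall>t\<ge>0. \<forall>T\<in>metric_filtration d t. conj_matrix A u T \<in> space_tensor (metric_filtration d t) A) \<longleftrightarrow>
    (\<forall>i j k l. d k l < d i j \<longrightarrow> u i k \<otimes> u j l = \<zero>)"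
proof -
  note [simp] = magic_unitaryD(1,2)[OF u]
  have conj: "conj_matrix A u T i j = finsum A (\<lambda>(k, l). T $ k $ l \<odot> (u i k \<otimes> u j l)) UNIV" for T i j
    by (simp add: conj_matrix_def)
  have closed: "conj_matrix A u T i j \<in> carrier A" for T i j
    by (auto simp: conj intro!: finsum_closed)
  show ?thesis
  proof (intro iffI allI impI ballI)
    fix i j k l
    assume pres: "\<forall>t\<ge>0. \<forall>T\<in>metric_filtration d t. conj_matrix A u T \<in> space_tensor (metric_filtration d t) A"
      and less: "d k l < d i j"
    define T :: "complex^'x^'x" where "T = (\<chi> i j. if i = k \<and> j = l then 1 else 0)"
    have "T \<in> metric_filtration d (d k l)"
      by (auto simp: T_def metric_filtration_def)
    then have "conj_matrix A u T i j = \<zero>"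
      using pres d less space_tensor_metric_filtration_iff[of "conj_matrix A u T" d "d k l"] closed by auto
    moreover have "conj_matrix A u T i j = u i k \<otimes> u j l"
      unfolding conj by (subst finsum_only[of _ "(k, l)"]) (auto simp: T_def split: if_splits)
    ultimately show "u i k \<otimes> u j l = \<zero>" by simp
  next
    fix t T
    assume zero: "\<forall>i j k l. d k l < d i j \<longrightarrow> u i k \<otimes> u j l = \<zero>"
      and T: "T \<in> metric_filtration d t"
    have "T $ k $ l \<odot> (u i k \<otimes> u j l) = \<zero>" if "t < d i j" for i j k l
      using T zero that by (cases "t < d k l") (auto simp: metric_filtration_def)
    then show "conj_matrix A u T \<in> space_tensor (metric_filtration d t) A"
      using closed
      by (subst space_tensor_metric_filtration_iff) (auto simp: conj intro!: add.finprod_one_eqI)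
  qed
qed

end

lemma W_star_isometry_relations_iff_banica_relations:
  fixes d :: "'x::finite \<Rightarrow> 'x \<Rightarrow> real"
  assumes A: "pre_cstar_algebra A" and d: "\<And>x y. 0 \<le> d x y"
  shows "W_star_isometry_relations linf uniform_trace point_basis (metric_filtration d) A u \<longleftrightarrow>
    banica_relations d A u"
proof -
  interpret pre_cstar_algebra A by (rule A)
  have "(\<forall>i j k l. d k l < d i j \<longrightarrow> u i k \<otimes>\<^bsub>A\<^esub> u j l = \<zero>\<^bsub>A\<^esub>) \<longleftrightarrow>
      (\<forall>i j k l. d k l \<noteq> d i j \<longrightarrow> u i k \<otimes>\<^bsub>A\<^esub> u j l = \<zero>\<^bsub>A\<^esub>)" if "magic_unitary A u"
    using intertwines_distances_of_strict[OF that, of d] by (metis order_less_irrefl)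
  then show ?thesis
    using commutes_with_distances_iff[of u d] conj_matrix_preserves_metric_filtration_iff[of u d, OF _ d]
      magic_unitary_iff_coaction[of u]
    unfolding W_star_isometry_relations_def banica_relations_def by metis
qed

section \<open>Free *-algebras\<close>

lemma word_star_word_star [simp]: "word_star (word_star w) = w"
  by (cases w) (simp add: rev_map comp_def apsnd_def map_prod_def case_prod_unfold)

lemma word_star_add: "word_star (v + w) = word_star w + word_star v"
  by (cases v; cases w) simp

lemma poly_mapping_additive_induct [case_names zero single add]:
  fixes a :: "'k \<Rightarrow>\<^sub>0 'v::comm_monoid_add"
  assumes "P 0" "\<And>k v. P (Poly_Mapping.single k v)" "\<And>a b. P a \<Longrightarrow> P b \<Longrightarrow> P (a + b)"
  shows "P a"
proof -
  have "P (\<Sum>k\<in>S. Poly_Mapping.single k (Poly_Mapping.lookup a k))" for S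
    using assms by (induction S rule: infinite_finite_induct) auto
  moreover have "(\<Sum>k\<in>Poly_Mapping.keys a. Poly_Mapping.single k (Poly_Mapping.lookup a k)) = a"
    by (rule poly_mapping_eqI) (simp add: lookup_sum lookup_single when_def in_keys_iff)
  ultimately show ?thesis by metis
qed

lemma free_star_algebra_simps [simp]:
  "carrier free_star_algebra = UNIV" "a \<otimes>\<^bsub>free_star_algebra\<^esub> b = a * b"
  "\<one>\<^bsub>free_star_algebra\<^esub> = 1" "\<zero>\<^bsub>free_star_algebra\<^esub> = 0"
  "a \<oplus>\<^bsub>free_star_algebra\<^esub> b = a + b"
  "c \<odot>\<^bsub>free_star_algebra\<^esub> a = Poly_Mapping.single 0 c * a"
  by (simp_all add: free_star_algebra_def)

lemma word_star_eq_iff: "word_star v = w \<longleftrightarrow> v = word_star w"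
  by (metis word_star_word_star)

lemma lookup_free_star:
  "Poly_Mapping.lookup (star free_star_algebra a) w = cnj (Poly_Mapping.lookup a (word_star w))"
  by (simp add: free_star_algebra_def lookup_sum lookup_single when_def word_star_eq_iff in_keys_iff)

lemma free_star_single:
  "star free_star_algebra (Poly_Mapping.single w c) = Poly_Mapping.single (word_star w) (cnj c)"
  by (rule poly_mapping_eqI) (auto simp: lookup_free_star lookup_single when_def)

lemma free_star_add:
  "star free_star_algebra (a + b) = star free_star_algebra a + star free_star_algebra b"
  by (rule poly_mapping_eqI) (simp add: lookup_free_star lookup_add)

lemma free_star_zero: "star free_star_algebra 0 = 0"
  by (rule poly_mapping_eqI) (simp add: lookup_free_star)

lemma free_star_mult:
  "star free_star_algebra (a * b) = star free_star_algebra b * star free_star_algebra a"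
proof (induction a rule: poly_mapping_additive_induct)
  case (single v c)
  show ?case
    by (induction b rule: poly_mapping_additive_induct)
      (simp_all add: free_star_zero free_star_single free_star_add mult_single word_star_add
        distrib_left distrib_right mult.commute)
qed (simp_all add: free_star_zero free_star_add distrib_left distrib_right)

text \<open>
  Multiplication by a scalar is defined as left multiplication by a multiple of the empty word. That
  it passes to the second factor of a product rests on the empty word being neutral on both sides.
\<close>

lemma free_scalar_central:
  "Poly_Mapping.single 0 c * a = a * Poly_Mapping.single (0 :: 'g star_word) (c :: complex)"
  by (induction a rule: poly_mapping_additive_induct)
    (simp_all add: mult_single mult.commute distrib_left distrib_right)

lemma word_star_zero [simp]: "word_star 0 = 0"
  by (simp add: zero_star_word_def)

lemma unital_star_algebra_free: "unital_star_algebra (free_star_algebra :: 'g star_poly star_algebra)"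
proof -
  let ?F = "free_star_algebra :: 'g star_poly star_algebra"
  have "ring ?F"
  proof (intro ringI abelian_groupI monoidI)
    fix a :: "'g star_poly"
    show "\<exists>b\<in>carrier ?F. b \<oplus>\<^bsub>?F\<^esub> a = \<zero>\<^bsub>?F\<^esub>"
      by (auto intro: exI[of _ "- a"])
  qed (simp_all add: algebra_simps)
  then show ?thesis
  proof (intro unital_star_algebra.intro unital_star_algebra_axioms.intro)
    fix a b :: "'g star_poly" and c :: complex
    show "a \<otimes>\<^bsub>?F\<^esub> (c \<odot>\<^bsub>?F\<^esub> b) = c \<odot>\<^bsub>?F\<^esub> (a \<otimes>\<^bsub>?F\<^esub> b)"
      unfolding free_star_algebra_simps by (metis free_scalar_central mult.assoc)
    show "star ?F (star ?F a) = a"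
      by (rule poly_mapping_eqI) (simp add: lookup_free_star)
    show "star ?F (c \<odot>\<^bsub>?F\<^esub> a) = cnj c \<odot>\<^bsub>?F\<^esub> star ?F a"
      by (simp add: free_star_mult free_star_single free_scalar_central)
  qed (simp_all add: free_star_mult free_star_add algebra_simps single_add mult_single single_one
        flip: mult.assoc)
qed

section \<open>Completions\<close>

locale cstar_seminormed_algebra = unital_star_algebra P for P :: "('a, 'm) star_algebra_scheme" (structure) +
  fixes p :: "'a \<Rightarrow> real"
  assumes cstar: "cstar_seminorm P p"
begin

lemma p_ge_0: "a \<in> carrier P \<Longrightarrow> 0 \<le> p a"
  and p_add: "a \<in> carrier P \<Longrightarrow> b \<in> carrier P \<Longrightarrow> p (a \<oplus> b) \<le> p a + p b"
  and p_smult: "a \<in> carrier P \<Longrightarrow> p (c \<odot> a) = cmod c * p a"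
  and p_mult: "a \<in> carrier P \<Longrightarrow> b \<in> carrier P \<Longrightarrow> p (a \<otimes> b) \<le> p a * p b"
  and p_star_mult: "a \<in> carrier P \<Longrightarrow> p (star P a \<otimes> a) = (p a)\<^sup>2"
  using cstar unfolding cstar_seminorm_def by blast+

lemma p_zero [simp]: "p \<zero> = 0"
  using p_smult[of \<zero> 0] by simp

lemma p_minus_commute: "a \<in> carrier P \<Longrightarrow> b \<in> carrier P \<Longrightarrow> p (a \<ominus> b) = p (b \<ominus> a)"
  using p_smult[of "b \<ominus> a" "-1"] by (simp add: a_minus_def minus_add a_comm)

lemma minus_eq_sum:
  assumes "a \<in> carrier P" "b \<in> carrier P" "c \<in> carrier P"
  shows "a \<ominus> c = (a \<ominus> b) \<oplus> (b \<ominus> c)"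
  using assms by (simp add: a_minus_def a_assoc[of a] a_assoc[symmetric, of "\<ominus> b"] l_neg)

lemma p_triangle:
  assumes "a \<in> carrier P" "b \<in> carrier P" "c \<in> carrier P"
  shows "p (a \<ominus> c) \<le> p (a \<ominus> b) + p (b \<ominus> c)"
  using assms p_add[of "a \<ominus> b" "b \<ominus> c"] by (simp add: minus_eq_sum[of a b c])

lemma p_diff_le:
  assumes "a \<in> carrier P" "b \<in> carrier P"
  shows "\<bar>p a - p b\<bar> \<le> p (a \<ominus> b)"
proof -
  have "a = (a \<ominus> b) \<oplus> b" "b = (b \<ominus> a) \<oplus> a"
    using assms by (simp_all add: a_minus_def a_assoc l_neg)
  then have "p a \<le> p (a \<ominus> b) + p b" "p b \<le> p (b \<ominus> a) + p a"
    using p_add[of "a \<ominus> b" b] p_add[of "b \<ominus> a" a] assms by simp_all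
  then show ?thesis
    using p_minus_commute[OF assms] by linarith
qed

lemma p_star [simp]:
  assumes "a \<in> carrier P"
  shows "p (star P a) = p a"
proof -
  have le: "p b \<le> p (star P b)" if "b \<in> carrier P" for b
  proof (cases "p b = 0")
    case False
    then show ?thesis
      using p_star_mult[OF that] p_mult[of "star P b" b] p_ge_0[OF that] that
      by (simp add: power2_eq_square)
  qed (use that p_ge_0 in auto)
  show ?thesis
    using le[OF assms] le[of "star P a"] assms by simp
qed

text \<open>
  Closeness of two families along a filter: along \<open>sequentially\<close> it says that two sequences differ by a null
  sequence, and along pairs of indices it expresses that a sequence is Cauchy. Each algebraic
  operation is shown once to respect it, for all filters.
\<close>

definition near :: "'i filter \<Rightarrow> ('i \<Rightarrow> 'a) \<Rightarrow> ('i \<Rightarrow> 'a) \<Rightarrow> bool" where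
  "near F s t \<longleftrightarrow> range s \<subseteq> carrier P \<and> range t \<subseteq> carrier P \<and> ((\<lambda>i. p (s i \<ominus> t i)) \<longlongrightarrow> 0) F"

lemma nearI:
  assumes "\<And>i. s i \<in> carrier P" "\<And>i. t i \<in> carrier P"
    "\<And>i. p (s i \<ominus> t i) \<le> g i" "(g \<longlongrightarrow> 0) F"
  shows "near F s t"
  unfolding near_def using assms
  by (auto intro!: Lim_null_comparison[OF _ assms(4)] always_eventually simp: p_ge_0)

lemma nearD:
  assumes "near F s t"
  shows "s i \<in> carrier P" "t i \<in> carrier P" "((\<lambda>i. p (s i \<ominus> t i)) \<longlongrightarrow> 0) F"
  using assms by (auto simp: near_def)

lemma near_refl: "range s \<subseteq> carrier P \<Longrightarrow> near F s s"
  by (intro nearI[where g = "\<lambda>_. 0"]) (auto simp: a_minus_def r_neg image_subset_iff)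

lemma near_sym: "near F s t \<Longrightarrow> near F t s"
  using nearD[of F s t] p_minus_commute
  by (intro nearI[where g = "\<lambda>i. p (s i \<ominus> t i)"]) (auto simp: p_minus_commute)

lemma near_trans:
  assumes "near F s t" "near F t r"
  shows "near F s r"
  using nearD[OF assms(1)] nearD[OF assms(2)]
  by (intro nearI[where g = "\<lambda>i. p (s i \<ominus> t i) + p (t i \<ominus> r i)"])
    (auto intro!: p_triangle tendsto_add_zero)

lemma near_add:
  assumes "near F s s'" "near F t t'"
  shows "near F (\<lambda>i. s i \<oplus> t i) (\<lambda>i. s' i \<oplus> t' i)"
proof (rule nearI)
  note [simp] = nearD(1,2)[OF assms(1)] nearD(1,2)[OF assms(2)]
  show "p ((s i \<oplus> t i) \<ominus> (s' i \<oplus> t' i)) \<le> p (s i \<ominus> s' i) + p (t i \<ominus> t' i)" for i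
  proof -
    have "(s i \<oplus> t i) \<ominus> (s' i \<oplus> t' i) = (s i \<ominus> s' i) \<oplus> (t i \<ominus> t' i)"
      by (simp add: a_minus_def minus_add a_ac)
    then show ?thesis
      using p_add[of "s i \<ominus> s' i" "t i \<ominus> t' i"] by simp
  qed
qed (use nearD[OF assms(1)] nearD[OF assms(2)] in \<open>auto intro!: tendsto_add_zero\<close>)

lemma near_smult:
  assumes "near F s s'"
  shows "near F (\<lambda>i. c \<odot> s i) (\<lambda>i. c \<odot> s' i)"
proof (rule nearI)
  note [simp] = nearD(1,2)[OF assms]
  show "p (c \<odot> s i \<ominus> c \<odot> s' i) \<le> cmod c * p (s i \<ominus> s' i)" for i
  proof -
    have "c \<odot> s i \<ominus> c \<odot> s' i = c \<odot> (s i \<ominus> s' i)"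
      by (simp add: minus_conv_smult smult_add mult.commute del: smult_minus_one)
    then show ?thesis
      by (simp add: p_smult)
  qed
qed (use nearD[OF assms] in \<open>auto intro!: tendsto_mult_right_zero\<close>)

lemma near_star:
  assumes "near F s s'"
  shows "near F (\<lambda>i. star P (s i)) (\<lambda>i. star P (s' i))"
proof (rule nearI)
  note [simp] = nearD(1,2)[OF assms]
  show "p (star P (s i) \<ominus> star P (s' i)) \<le> p (s i \<ominus> s' i)" for i
  proof -
    have "star P (s i) \<ominus> star P (s' i) = star P (s i \<ominus> s' i)"
      by (simp add: minus_conv_smult star_add star_smult del: smult_minus_one)
    then show ?thesis by simp
  qed
qed (use nearD[OF assms] in auto)

lemma near_mult:
  assumes "near F s s'" "near F t t'" and M: "\<And>i. p (s i) \<le> M" "\<And>i. p (t' i) \<le> M"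
  shows "near F (\<lambda>i. s i \<otimes> t i) (\<lambda>i. s' i \<otimes> t' i)"
proof (rule nearI)
  note [simp] = nearD(1,2)[OF assms(1)] nearD(1,2)[OF assms(2)]
  show "p (s i \<otimes> t i \<ominus> s' i \<otimes> t' i) \<le> M * p (t i \<ominus> t' i) + p (s i \<ominus> s' i) * M" for i
  proof -
    have "s i \<otimes> t i \<ominus> s' i \<otimes> t' i = (s i \<otimes> t i \<ominus> s i \<otimes> t' i) \<oplus> (s i \<otimes> t' i \<ominus> s' i \<otimes> t' i)"
      by (intro minus_eq_sum) auto
    also have "\<dots> = s i \<otimes> (t i \<ominus> t' i) \<oplus> (s i \<ominus> s' i) \<otimes> t' i"
      by (simp add: a_minus_def l_distr r_distr l_minus r_minus)
    also have "p \<dots> \<le> p (s i) * p (t i \<ominus> t' i) + p (s i \<ominus> s' i) * p (t' i)"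
      using p_add[of "s i \<otimes> (t i \<ominus> t' i)" "(s i \<ominus> s' i) \<otimes> t' i"]
        p_mult[of "s i" "t i \<ominus> t' i"] p_mult[of "s i \<ominus> s' i" "t' i"] by simp
    also have "\<dots> \<le> M * p (t i \<ominus> t' i) + p (s i \<ominus> s' i) * M"
      using M by (intro add_mono mult_left_mono mult_right_mono) (auto intro!: p_ge_0)
    finally show ?thesis .
  qed
  show "((\<lambda>i. M * p (t i \<ominus> t' i) + p (s i \<ominus> s' i) * M) \<longlongrightarrow> 0) F"
    using nearD[OF assms(1)] nearD[OF assms(2)]
    by (auto intro!: tendsto_add_zero tendsto_mult_right_zero tendsto_mult_left_zero)
qed (use nearD[OF assms(1)] nearD[OF assms(2)] in auto)

abbreviation "CS \<equiv> cauchy_seqs P p"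
abbreviation "cls \<equiv> cauchy_class P p"

abbreviation pairs :: "(nat \<times> nat) filter" where
  "pairs \<equiv> sequentially \<times>\<^sub>F sequentially"

lemma cauchy_seqs_iff: "s \<in> CS \<longleftrightarrow> near pairs (\<lambda>i. s (fst i)) (\<lambda>i. s (snd i))"
proof -
  have "(\<forall>\<epsilon>>0. \<exists>N. \<forall>m\<ge>N. \<forall>n\<ge>N. p (s m \<ominus> s n) < \<epsilon>) \<longleftrightarrow>
      ((\<lambda>i. p (s (fst i) \<ominus> s (snd i))) \<longlongrightarrow> 0) pairs" if "range s \<subseteq> carrier P"
  proof -
    have "\<bar>p (s m \<ominus> s n)\<bar> = p (s m \<ominus> s n)" for m n
      using that p_ge_0[of "s m \<ominus> s n"] by (auto simp: image_subset_iff)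
    then show ?thesis
      unfolding tendsto_iff eventually_prod_sequentially by (auto simp: dist_real_def) blast+
  qed
  moreover have "range (\<lambda>i :: nat \<times> nat. s (fst i)) = range s" "range (\<lambda>i :: nat \<times> nat. s (snd i)) = range s"
    by (force simp: image_iff)+
  ultimately show ?thesis
    by (auto simp: cauchy_seqs_def near_def)
qed

lemma cauchy_seqs_closed [simp]: "s \<in> CS \<Longrightarrow> s n \<in> carrier P"
  by (auto simp: cauchy_seqs_def)

lemma cauchy_seqs_const [simp]: "a \<in> carrier P \<Longrightarrow> (\<lambda>_. a) \<in> CS"
  unfolding cauchy_seqs_iff by (rule near_refl) auto

lemma cauchy_seqs_add [simp]: "s \<in> CS \<Longrightarrow> t \<in> CS \<Longrightarrow> (\<lambda>n. s n \<oplus> t n) \<in> CS"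
  unfolding cauchy_seqs_iff by (rule near_add)

lemma cauchy_seqs_smult [simp]: "s \<in> CS \<Longrightarrow> (\<lambda>n. c \<odot> s n) \<in> CS"
  unfolding cauchy_seqs_iff by (rule near_smult)

lemma cauchy_seqs_star [simp]: "s \<in> CS \<Longrightarrow> (\<lambda>n. star P (s n)) \<in> CS"
  unfolding cauchy_seqs_iff by (rule near_star)

lemma cauchy_seqs_norm_convergent:
  assumes "s \<in> CS"
  shows "convergent (\<lambda>n. p (s n))"
proof (rule real_Cauchy_convergent, rule metric_CauchyI)
  fix e :: real assume "e > 0"
  then obtain N where "\<forall>m\<ge>N. \<forall>n\<ge>N. p (s m \<ominus> s n) < e"
    using assms unfolding cauchy_seqs_def by blast
  moreover have "dist (p (s m)) (p (s n)) \<le> p (s m \<ominus> s n)" for m n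
    using p_diff_le assms by (simp add: dist_real_def)
  ultimately show "\<exists>N. \<forall>m\<ge>N. \<forall>n\<ge>N. dist (p (s m)) (p (s n)) < e"
    by (meson order_le_less_trans)
qed

lemma cauchy_seqs_bounded:
  assumes "s \<in> CS"
  obtains M where "\<And>n. p (s n) \<le> M"
proof -
  have "Bseq (\<lambda>n. p (s n))"
    using cauchy_seqs_norm_convergent[OF assms] by (rule convergent_imp_Bseq)
  then obtain K where "\<And>n. norm (p (s n)) \<le> K"
    unfolding Bseq_def by blast
  then show ?thesis
    using that[of K] by (simp add: abs_le_iff)
qed

lemma cauchy_seqs_bounded2:
  assumes "s \<in> CS" "t \<in> CS"
  obtains M where "\<And>n. p (s n) \<le> M" "\<And>n. p (t n) \<le> M"
proof -
  obtain M N where "\<And>n. p (s n) \<le> M" "\<And>n. p (t n) \<le> N"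
    using assms cauchy_seqs_bounded by metis
  then show ?thesis
    using that[of "max M N"] by (simp add: le_max_iff_disj)
qed

lemma cauchy_seqs_mult [simp]:
  assumes "s \<in> CS" "t \<in> CS"
  shows "(\<lambda>n. s n \<otimes> t n) \<in> CS"
proof -
  obtain M where "\<And>n. p (s n) \<le> M" "\<And>n. p (t n) \<le> M"
    using cauchy_seqs_bounded2[OF assms] by blast
  then show ?thesis
    using assms unfolding cauchy_seqs_iff by (intro near_mult[where M = M]) auto
qed

lemma cauchy_class_mem: "s \<in> CS \<Longrightarrow> t \<in> cls s \<longleftrightarrow> t \<in> CS \<and> near sequentially s t"
  by (auto simp: cauchy_class_def near_def)

lemma cauchy_class_eq:
  assumes "s \<in> CS" "t \<in> CS"
  shows "cls s = cls t \<longleftrightarrow> near sequentially s t"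
proof
  assume "cls s = cls t"
  moreover have "t \<in> cls t"
    using assms by (auto simp: cauchy_class_mem intro!: near_refl)
  ultimately have "t \<in> cls s" by simp
  then show "near sequentially s t"
    using assms by (simp add: cauchy_class_mem)
next
  assume "near sequentially s t"
  then have "near sequentially s r \<longleftrightarrow> near sequentially t r" for r
    using near_trans near_sym by metis
  then show "cls s = cls t"
    using assms by (auto simp: cauchy_class_mem)
qed

text \<open>
  The completion defines its operations by unions over all representatives. When the operation
  respects null differences all the united classes are equal, and any representatives will do.
\<close>

lemma class_unary_op:
  assumes s: "s \<in> CS" and closed: "\<And>s. s \<in> CS \<Longrightarrow> F s \<in> CS"
    and near: "\<And>s'. s' \<in> CS \<Longrightarrow> near sequentially s s' \<Longrightarrow> near sequentially (F s) (F s')"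
  shows "(\<Union>s'\<in>cls s. cls (F s')) = cls (F s)"
proof -
  have "cls (F s') = cls (F s)" if "s' \<in> cls s" for s'
    using that s closed near[of s'] by (simp add: cauchy_class_mem cauchy_class_eq near_sym)
  moreover have "s \<in> cls s"
    using s by (auto simp: cauchy_class_mem intro!: near_refl)
  ultimately show ?thesis by blast
qed

lemma class_binary_op:
  assumes "s \<in> CS" "t \<in> CS" and closed: "\<And>s t. s \<in> CS \<Longrightarrow> t \<in> CS \<Longrightarrow> F s t \<in> CS"
    and near: "\<And>s' t'. s' \<in> CS \<Longrightarrow> t' \<in> CS \<Longrightarrow> near sequentially s s' \<Longrightarrow> near sequentially t t' \<Longrightarrow>
      near sequentially (F s t) (F s' t')"
  shows "(\<Union>s'\<in>cls s. \<Union>t'\<in>cls t. cls (F s' t')) = cls (F s t)"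
proof -
  have "cls (F s' t') = cls (F s t)" if "s' \<in> cls s" "t' \<in> cls t" for s' t'
    using that assms(1,2) closed near[of s' t'] by (simp add: cauchy_class_mem cauchy_class_eq near_sym)
  moreover have "s \<in> cls s" "t \<in> cls t"
    using assms(1,2) by (auto simp: cauchy_class_mem intro!: near_refl)
  ultimately show ?thesis by blast
qed

lemma completion_add:
  assumes "s \<in> CS" "t \<in> CS"
  shows "cls s \<oplus>\<^bsub>completion P p\<^esub> cls t = cls (\<lambda>n. s n \<oplus> t n)"
proof -
  have "(\<Union>s'\<in>cls s. \<Union>t'\<in>cls t. cls (\<lambda>n. s' n \<oplus> t' n)) = cls (\<lambda>n. s n \<oplus> t n)"
    by (rule class_binary_op[OF assms]) (rule cauchy_seqs_add near_add, assumption+)+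
  then show ?thesis by (simp add: completion_def)
qed

lemma completion_mult:
  assumes "s \<in> CS" "t \<in> CS"
  shows "cls s \<otimes>\<^bsub>completion P p\<^esub> cls t = cls (\<lambda>n. s n \<otimes> t n)"
proof -
  have "near sequentially (\<lambda>n. s n \<otimes> t n) (\<lambda>n. s' n \<otimes> t' n)"
    if t': "t' \<in> CS" and near: "near sequentially s s'" "near sequentially t t'" for s' t'
  proof -
    obtain M where "\<And>n. p (s n) \<le> M" "\<And>n. p (t' n) \<le> M"
      using cauchy_seqs_bounded2[OF assms(1) t'] by blast
    with near show ?thesis by (rule near_mult)
  qed
  then have "(\<Union>s'\<in>cls s. \<Union>t'\<in>cls t. cls (\<lambda>n. s' n \<otimes> t' n)) = cls (\<lambda>n. s n \<otimes> t n)"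
    by (intro class_binary_op[OF assms] cauchy_seqs_mult)
  then show ?thesis by (simp add: completion_def)
qed

lemma completion_smult:
  assumes "s \<in> CS"
  shows "c \<odot>\<^bsub>completion P p\<^esub> cls s = cls (\<lambda>n. c \<odot> s n)"
proof -
  have "(\<Union>s'\<in>cls s. cls (\<lambda>n. c \<odot> s' n)) = cls (\<lambda>n. c \<odot> s n)"
    by (rule class_unary_op[OF assms]) (rule cauchy_seqs_smult near_smult, assumption)+
  then show ?thesis by (simp add: completion_def)
qed

lemma completion_star:
  assumes "s \<in> CS"
  shows "star (completion P p) (cls s) = cls (\<lambda>n. star P (s n))"
proof -
  have "(\<Union>s'\<in>cls s. cls (\<lambda>n. star P (s' n))) = cls (\<lambda>n. star P (s n))"
    by (rule class_unary_op[OF assms]) (rule cauchy_seqs_star near_star, assumption)+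
  then show ?thesis by (simp add: completion_def)
qed

text \<open>
  The norm of a class is defined from a chosen representative; the norms along any other one have the
  same limit.
\<close>

lemma completion_nrm:
  assumes "s \<in> CS"
  shows "(\<lambda>n. p (s n)) \<longlonglongrightarrow> nrm (completion P p) (cls s)"
proof -
  let ?s' = "SOME s'. s' \<in> cls s"
  have "s \<in> cls s"
    using assms by (auto simp: cauchy_class_mem intro!: near_refl)
  then have "?s' \<in> cls s"
    by (rule someI[where P = "\<lambda>s'. s' \<in> cls s"])
  then have s': "?s' \<in> CS" and near: "near sequentially s ?s'"
    using assms by (auto simp: cauchy_class_mem)
  have lim: "(\<lambda>n. p (?s' n)) \<longlonglongrightarrow> nrm (completion P p) (cls s)"
    using cauchy_seqs_norm_convergent[OF s'] by (simp add: completion_def convergent_LIMSEQ_iff)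
  have "(\<lambda>n. p (s n) - p (?s' n)) \<longlonglongrightarrow> 0"
    using nearD[OF near] p_diff_le
    by (intro Lim_null_comparison[OF _ nearD(3)[OF near]]) auto
  from tendsto_add[OF this lim] show ?thesis by simp
qed

lemma completion_carrier: "carrier (completion P p) = cls ` CS"
  and completion_one: "\<one>\<^bsub>completion P p\<^esub> = cls (\<lambda>_. \<one>)"
  and completion_zero: "\<zero>\<^bsub>completion P p\<^esub> = cls (\<lambda>_. \<zero>)"
  by (simp_all add: completion_def)

lemmas completion_simps =
  completion_add completion_mult completion_smult completion_star completion_one completion_zero
  completion_carrier

lemma ring_completion: "ring (completion P p)"
proof (intro ringI abelian_groupI monoidI)
  fix S assume "S \<in> carrier (completion P p)"
  then obtain s where "s \<in> CS" "S = cls s"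
    by (auto simp: completion_carrier)
  then show "\<exists>T\<in>carrier (completion P p). T \<oplus>\<^bsub>completion P p\<^esub> S = \<zero>\<^bsub>completion P p\<^esub>"
    by (intro bexI[of _ "cls (\<lambda>n. (-1) \<odot> s n)"]) (simp_all add: completion_simps l_neg del: smult_minus_one, simp add: l_neg)
qed (auto simp: completion_simps l_distr r_distr intro!: arg_cong[where f = cls] simp: a_ac m_assoc)

lemma pre_cstar_algebra_completion: "pre_cstar_algebra (completion P p)"
proof -
  let ?C = "completion P p"
  have "unital_star_algebra ?C"
    by (intro unital_star_algebra.intro ring_completion unital_star_algebra_axioms.intro)
      (auto simp: completion_simps smult_scalar_add smult_add star_add star_mult star_smult)
  moreover have "cstar_seminorm ?C (nrm ?C)"
    unfolding cstar_seminorm_def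
  proof (intro conjI ballI allI)
    fix S T c assume "S \<in> carrier ?C" "T \<in> carrier ?C"
    then obtain s t where s: "s \<in> CS" "S = cls s" and t: "t \<in> CS" "T = cls t"
      by (auto simp: completion_carrier)
    note lims = completion_nrm[OF s(1)] completion_nrm[OF t(1)]
    show "0 \<le> nrm ?C S"
      unfolding s(2) using s(1) by (intro LIMSEQ_le_const[OF lims(1)]) (auto intro!: p_ge_0)
    show "nrm ?C (S \<oplus>\<^bsub>?C\<^esub> T) \<le> nrm ?C S + nrm ?C T"
      using s t LIMSEQ_le[OF completion_nrm[of "\<lambda>n. s n \<oplus> t n"] tendsto_add[OF lims]] p_add
      by (simp add: completion_simps)
    show "nrm ?C (S \<otimes>\<^bsub>?C\<^esub> T) \<le> nrm ?C S * nrm ?C T"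
      using s t LIMSEQ_le[OF completion_nrm[of "\<lambda>n. s n \<otimes> t n"] tendsto_mult[OF lims]] p_mult
      by (simp add: completion_simps)
    show "nrm ?C (c \<odot>\<^bsub>?C\<^esub> S) = cmod c * nrm ?C S"
      using s LIMSEQ_unique[OF completion_nrm[of "\<lambda>n. c \<odot> s n"]] tendsto_mult_left[OF lims(1), of "cmod c"]
      by (simp add: completion_simps p_smult)
    show "nrm ?C (star ?C S \<otimes>\<^bsub>?C\<^esub> S) = (nrm ?C S)\<^sup>2"
      using s LIMSEQ_unique[OF completion_nrm[of "\<lambda>n. star P (s n) \<otimes> s n"]] tendsto_power[OF lims(1), of 2]
      by (simp add: completion_simps p_star_mult)
  qed
  moreover have "S = \<zero>\<^bsub>?C\<^esub>" if "S \<in> carrier ?C" and zero: "nrm ?C S = 0" for S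
  proof -
    obtain s where s: "s \<in> CS" "S = cls s"
      using \<open>S \<in> carrier ?C\<close> by (auto simp: completion_carrier)
    then have "near sequentially s (\<lambda>_. \<zero>)"
      using completion_nrm[OF s(1)] zero by (auto simp: near_def a_minus_def)
    then show ?thesis
      using s by (simp add: completion_zero cauchy_class_eq)
  qed
  ultimately show ?thesis
    by (intro pre_cstar_algebra.intro pre_cstar_algebra_axioms.intro)
qed

end

section \<open>Equality of the universal objects\<close>

text \<open>
  Both the universal algebra and its generators are determined by the set of admissible seminorms.
\<close>

lemma universal_cstar_algebra_cong:
  assumes "\<And>p. cstar_seminorm free_star_algebra p \<Longrightarrow>
    R (completion free_star_algebra p) (generator_matrix p) \<longleftrightarrow>
    R' (completion free_star_algebra p) (generator_matrix p)"
  shows "universal_cstar_algebra R = universal_cstar_algebra R'"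
    and "universal_matrix R = universal_matrix R'"
proof -
  have "admissible_seminorm R = admissible_seminorm R'"
    using assms by (auto simp: admissible_seminorm_def fun_eq_iff)
  then have "universal_seminorm R = universal_seminorm R'"
    by (simp add: universal_seminorm_def fun_eq_iff)
  then show "universal_cstar_algebra R = universal_cstar_algebra R'"
    and "universal_matrix R = universal_matrix R'"
    by (simp_all add: universal_cstar_algebra_def universal_matrix_def)
qed

lemma unital_star_hom_id: "unital_star_hom A A id"
  by (auto simp: unital_star_hom_def intro!: ring_hom_memI)

lemma cqg_isomorphic_refl: "cqg_isomorphic G G"
  unfolding cqg_isomorphic_def by (intro exI[of _ id]) (simp add: unital_star_hom_id)

theorem proposition5p13:
  fixes d :: "'x::finite \<Rightarrow> 'x \<Rightarrow> real"
  assumes "Metric_space UNIV d"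
  shows "cqg_isomorphic
           (W_star_quantum_isometry_group linf uniform_trace point_basis (metric_filtration d))
           (banica_quantum_isometry_group d)"
proof -
  let ?R = "W_star_isometry_relations linf uniform_trace point_basis (metric_filtration d)"
  interpret Metric_space UNIV d by fact
  have iff: "?R (completion free_star_algebra p) (generator_matrix p) \<longleftrightarrow>
      banica_relations d (completion free_star_algebra p) (generator_matrix p)"
    if "cstar_seminorm free_star_algebra p" for p :: "('x \<times> 'x) star_poly \<Rightarrow> real"
  proof -
    interpret cstar_seminormed_algebra "free_star_algebra :: ('x \<times> 'x) star_poly star_algebra" p
      using that unital_star_algebra_free
      by (intro cstar_seminormed_algebra.intro cstar_seminormed_algebra_axioms.intro)
    show ?thesis
      by (intro W_star_isometry_relations_iff_banica_relations pre_cstar_algebra_completion nonneg)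
  qed
  have "W_star_quantum_isometry_group linf uniform_trace point_basis (metric_filtration d) =
      banica_quantum_isometry_group d"
    unfolding W_star_quantum_isometry_group_def banica_quantum_isometry_group_def
    using universal_cstar_algebra_cong[of ?R "banica_relations d", OF iff] by simp
  then show ?thesis
    by (simp add: cqg_isomorphic_refl)
qed

end
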